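(* Let $d$ and $N$ be integers with $d \geq 2$ and $N \geq 2$, and let $(c_1, c_2, c_3, \dots)$ be a nonincreasing sequence of numbers in $[0,1]$. Then there exists a strictly stationary random field $X := (X_k, k \in \mathbf{Z}^d)$ of real-valued random variables with the following properties: (A) $X_{\mathbf{0}}$ is uniformly distributed on $[0,1]$; (B) $X$ satisfies $N$-tuplewise independence; (C) $\rho^*(X,n) = 1$ for every positive integer $n$, and $\rho(X,1) = \rho'(X,1) = 1$; (D) for every integer $n \geq 2$, $\rho(X,n) = \rho'(X,n) = c_n$.
   Context: All random variables are defined on a common probability space $(\Omega,\mathcal{F},P)$. For $k\in\mathbf{Z}^d$, $k=(k_1,\dots,k_d)$ and $\|k\|$ is the Euclidean norm; for nonempty disjoint $S,T\subset\mathbf{Z}^d$, $\mathrm{dist}(S,T)=\min_{s\in S,t\in T}\|s-t\|$ (and for subsets of $\mathbf{Z}$, $\mathrm{dist}(G,H)=\min_{g\in G,h\in H}|g-h|$). $\mathbf{0}=(0,\dots,0)$. A random field $X=(X_k,k\in\mathbf{Z}^d)$ satisfies $N$-tuplewise independence if for every choice of $N$ distinct $k(1),\dots,k(N)\in\mathbf{Z}^d$ the random variables $X_{k(1)},\dots,X_{k(N)}$ are independent. For $\sigma$-fields $\mathcal{A},\mathcal{B}\subset\mathcal{F}$: $\rho(\mathcal{A},\mathcal{B}) := \sup|\mathrm{Corr}(f,g)|$ over all square-integrable $f$ that are $\mathcal{A}$-measurable and $g$ that are $\mathcal{B}$-measurable. For a random field $X$ and $n\in\mathbf{N}$: $\rho(X,n)$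 is the supremum of $\rho(\sigma(X_k,k\in S),\sigma(X_k,k\in T))$ over all pairs $S=\{k\in\mathbf{Z}^d:k_u\le j\}$, $T=\{k\in\mathbf{Z}^d:k_u\ge j+n\}$ with $j\in\mathbf{Z}$, $u\in\{1,\dots,d\}$; $\rho'(X,n)$ is the same supremum over all $S=\{k:k_u\in G\}$, $T=\{k:k_u\in H\}$ with $u\in\{1,\dots,d\}$ and $G,H\subset\mathbf{Z}$ nonempty, disjoint, $\mathrm{dist}(G,H)\ge n$; $\rho^*(X,n)$ is the same supremum over all nonempty disjoint $S,T\subset\mathbf{Z}^d$ with $\mathrm{dist}(S,T)\ge n$. *)

theory Defs
  imports "HOL-Probability.Probability"
begin

text \<open>Lattice points of Z^d are rendered as int^'d for a finite index type 'd
  (d = CARD('d)).  Random fields are families X :: int^'d => 'w => real of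
  real-valued random variables on a measure space M.\<close>

definition lat_norm :: "int^'d \<Rightarrow> real" where
  "lat_norm k = sqrt (\<Sum>u\<in>UNIV. (real_of_int (k $ u))\<^sup>2)"

definition gen_sigma :: "'w measure \<Rightarrow> ('i \<Rightarrow> 'w \<Rightarrow> real) \<Rightarrow> 'i set \<Rightarrow> 'w measure" where
  "gen_sigma M X S = sigma (space M) {X k -` B \<inter> space M | k B. k \<in> S \<and> B \<in> sets borel}"

definition covar :: "'w measure \<Rightarrow> ('w \<Rightarrow> real) \<Rightarrow> ('w \<Rightarrow> real) \<Rightarrow> real" where
  "covar M f g = (LINT x|M. (f x - (LINT y|M. f y)) * (g x - (LINT y|M. g y)))"

text \<open>Correlation; by the convention x / 0 = 0 it is 0 if a variance vanishes.\<close>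
definition corr :: "'w measure \<Rightarrow> ('w \<Rightarrow> real) \<Rightarrow> ('w \<Rightarrow> real) \<Rightarrow> real" where
  "corr M f g = covar M f g / sqrt (covar M f f * covar M g g)"

definition max_corr :: "'w measure \<Rightarrow> 'w measure \<Rightarrow> 'w measure \<Rightarrow> real" where
  "max_corr M A B = Sup {\<bar>corr M f g\<bar> | f g.
      f \<in> borel_measurable M \<and> f \<in> borel_measurable A \<and> integrable M (\<lambda>x. (f x)\<^sup>2) \<and>
      g \<in> borel_measurable M \<and> g \<in> borel_measurable B \<and> integrable M (\<lambda>x. (g x)\<^sup>2)}"

definition rho_coef :: "'w measure \<Rightarrow> (int^'d \<Rightarrow> 'w \<Rightarrow> real) \<Rightarrow> nat \<Rightarrow> real" where
  "rho_coef M X n = Sup {max_corr M (gen_sigma M X {k. k $ u \<le> j}) (gen_sigma M X {k. k $ u \<ge> j + int n})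
      | j u. True}"

definition rho_prime :: "'w measure \<Rightarrow> (int^'d \<Rightarrow> 'w \<Rightarrow> real) \<Rightarrow> nat \<Rightarrow> real" where
  "rho_prime M X n = Sup {max_corr M (gen_sigma M X {k. k $ u \<in> G}) (gen_sigma M X {k. k $ u \<in> H})
      | u G H. G \<noteq> {} \<and> H \<noteq> {} \<and> G \<inter> H = {} \<and> (\<forall>g\<in>G. \<forall>h\<in>H. real n \<le> real_of_int \<bar>g - h\<bar>)}"

definition rho_star :: "'w measure \<Rightarrow> (int^'d \<Rightarrow> 'w \<Rightarrow> real) \<Rightarrow> nat \<Rightarrow> real" where
  "rho_star M X n = Sup {max_corr M (gen_sigma M X S) (gen_sigma M X T)
      | S T. S \<noteq> {} \<and> T \<noteq> {} \<and> S \<inter> T = {} \<and> (\<forall>s\<in>S. \<forall>t\<in>T. real n \<le> lat_norm (s - t))}"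

definition strictly_stationary :: "'w measure \<Rightarrow> (int^'d \<Rightarrow> 'w \<Rightarrow> real) \<Rightarrow> bool" where
  "strictly_stationary M X \<longleftrightarrow> (\<forall>m J. finite J \<longrightarrow>
      distr M (PiM J (\<lambda>_. borel)) (\<lambda>\<omega>. \<lambda>k\<in>J. X (k + m) \<omega>) =
      distr M (PiM J (\<lambda>_. borel)) (\<lambda>\<omega>. \<lambda>k\<in>J. X k \<omega>))"

definition tuplewise_indep :: "'w measure \<Rightarrow> ('i \<Rightarrow> 'w \<Rightarrow> real) \<Rightarrow> nat \<Rightarrow> bool" where
  "tuplewise_indep M X N \<longleftrightarrow> (\<forall>K. finite K \<and> card K = N \<longrightarrow> prob_space.indep_vars M (\<lambda>_. borel) X K)"

end

theory Submission
  imports Defs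
begin

text \<open>Take finite clusters of fair bits of size larger than \<open>N\<close>, placed at all translates of a fixed
  pattern in \<open>\<int>\<^sup>d\<close>, mutually independent, and with the parity of each cluster biased by \<open>\<kappa>\<close>. Any proper
  subset of a cluster is independent; two disjoint sets of sites are dependent only through clusters
  that they split between them, and such a cluster has maximal correlation exactly \<open>\<kappa>\<close>. Since maximal
  correlation tensorizes over independent pairs, the maximal correlation of the whole field is the largest
  \<open>\<kappa>\<close> of a split cluster. Countably many cluster shapes are superimposed by using the bits at a site as
  the binary digits of a uniform variable. A pattern whose coordinate projections are intervals dilated
  by \<open>s\<close> is split by strips at distance \<open>n\<close> only if \<open>n \<le> s\<close>, and monotonicity of \<open>c\<close> does the rest.\<close>

section \<open>Square-integrable functions and covariance\<close>

text \<open>Parity is the right statistic because, among the signs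
  \<open>(-1) ^ card (A \<inter> I)\<close> with \<open>I\<close> nonempty, only the one over the
  whole cluster can have a nonzero mean, namely \<kappa>. The covariance of functions of two
  complementary parts therefore reduces to \<kappa> times one coefficient of each, which gives the
  upper bound, and the two signs themselves attain it.

  Requirements (C) and (D) pull against each other: distances in the norm ask for bias-1 clusters
  with halves far apart, which strips at distance 2 must not be able to split. Strips see one
  coordinate at a time, so a cluster may have a wide gap in space and yet gapless projections; this
  is where a second coordinate enters. A cluster of scale \<open>s\<close> is also split at
  distances below \<open>s\<close>, so its bias must not exceed the coefficients prescribed there:
  this is the role of monotonicity.

  Upper bounds concern functions of infinitely many variables and come from finite products by
  density in L2; lower bounds need the bits back from the field, which is possible off the dyadic
  rationals.\<close>

definition L2 :: "'a measure \<Rightarrow> ('a \<Rightarrow> real) \<Rightarrow> bool" where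
  "L2 M f \<longleftrightarrow> f \<in> borel_measurable M \<and> integrable M (\<lambda>x. (f x)\<^sup>2)"

lemma L2_D: "L2 M f \<Longrightarrow> f \<in> borel_measurable M"
  by (simp add: L2_def)

lemma L2_square: "L2 M f \<Longrightarrow> integrable M (\<lambda>x. (f x)\<^sup>2)"
  by (simp add: L2_def)

lemma L2_mult_integrable:
  assumes "L2 M f" "L2 M g"
  shows "integrable M (\<lambda>x. f x * g x)"
proof (rule Bochner_Integration.integrable_bound)
  show "integrable M (\<lambda>x. (f x)\<^sup>2 + (g x)\<^sup>2)"
    using assms by (simp add: L2_def)
  show "(\<lambda>x. f x * g x) \<in> borel_measurable M"
    using assms by (auto simp: L2_def)
  have "\<bar>a * b\<bar> \<le> a\<^sup>2 + b\<^sup>2" for a b :: real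
    using sum_squares_bound[of "\<bar>a\<bar>" "\<bar>b\<bar>"] zero_le_power2[of a] zero_le_power2[of b]
      mult_nonneg_nonneg[of "\<bar>a\<bar>" "\<bar>b\<bar>"] unfolding abs_mult power2_abs by linarith
  then show "AE x in M. norm (f x * g x) \<le> norm ((f x)\<^sup>2 + (g x)\<^sup>2)"
    by simp
qed

lemma L2_add: assumes "L2 M f" "L2 M g" shows "L2 M (\<lambda>x. f x + g x)"
  using assms L2_mult_integrable[OF assms] unfolding L2_def
  by (auto simp: power2_sum mult.assoc)

lemma L2_scale: "L2 M f \<Longrightarrow> L2 M (\<lambda>x. c * f x)"
  unfolding L2_def by (auto simp: power_mult_distrib)

lemma L2_diff: assumes "L2 M f" "L2 M g" shows "L2 M (\<lambda>x. f x - g x)"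
  using L2_add[OF assms(1) L2_scale[OF assms(2), of "-1"]] by simp

lemma (in finite_measure) L2_bounded:
  assumes "f \<in> borel_measurable M" "\<And>x. \<bar>f x\<bar> \<le> B"
  shows "L2 M f"
  unfolding L2_def
proof
  show "integrable M (\<lambda>x. (f x)\<^sup>2)"
  proof (rule integrable_const_bound[where B = "B\<^sup>2"])
    show "AE x in M. norm ((f x)\<^sup>2) \<le> B\<^sup>2"
      using power_mono[OF assms(2), of _ 2] by simp
  qed (use assms(1) in measurable)
qed (fact assms(1))

lemma (in finite_measure) L2_const: "L2 M (\<lambda>_. c)"
  by (rule L2_bounded[of _ "\<bar>c\<bar>"]) auto

lemma (in finite_measure) L2_integrable: assumes "L2 M f" shows "integrable M f"
  using L2_mult_integrable[OF assms L2_const[of 1]] by simp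

text \<open>The integral of \<open>(t * f x - g x)\<^sup>2\<close> is a quadratic in
  \<open>t\<close> that never becomes negative.\<close>

lemma integral_Cauchy_Schwarz:
  assumes "L2 M f" "L2 M g"
  shows "(LINT x|M. f x * g x)\<^sup>2 \<le> (LINT x|M. (f x)\<^sup>2) * (LINT x|M. (g x)\<^sup>2)"
proof -
  define F G H where "F = (LINT x|M. (f x)\<^sup>2)" and "G = (LINT x|M. (g x)\<^sup>2)"
    and "H = (LINT x|M. f x * g x)"
  have *: "0 \<le> t\<^sup>2 * F - 2 * t * H + G" for t
  proof -
    have "0 \<le> (LINT x|M. (t * f x - g x)\<^sup>2)" by simp
    also have "\<dots> = (LINT x|M. t\<^sup>2 * (f x)\<^sup>2 - 2 * t * (f x * g x) + (g x)\<^sup>2)"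
      by (rule Bochner_Integration.integral_cong) (auto simp: power2_eq_square algebra_simps)
    also have "\<dots> = t\<^sup>2 * F - 2 * t * H + G"
      using assms L2_mult_integrable[OF assms] unfolding F_def G_def H_def
      by (simp add: L2_def)
    finally show ?thesis .
  qed
  have "H\<^sup>2 \<le> F * G"
  proof (cases "F = 0")
    case True
    have "H = 0"
    proof (rule ccontr)
      assume "H \<noteq> 0"
      \<comment> \<open>Without the quadratic term, this \<open>t\<close> turns the expression into
        -1.\<close>
      then show False using *[of "(G + 1) / (2 * H)"] True by (simp add: field_simps)
    qed
    then show ?thesis using True by simp
  next
    case False
    moreover have "0 \<le> F" unfolding F_def by simp
    ultimately have "0 < F" by simp
    \<comment> \<open>\<open>H / F\<close> is the minimizer of the quadratic.\<close>
    have "0 \<le> F * ((H / F)\<^sup>2 * F - 2 * (H / F) * H + G)"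
      using *[of "H / F"] \<open>0 < F\<close> by (intro mult_nonneg_nonneg) auto
    also have "\<dots> = F * G - H\<^sup>2"
      using \<open>0 < F\<close> by (simp add: field_simps power2_eq_square)
    finally show ?thesis by simp
  qed
  then show ?thesis by (simp add: F_def G_def H_def)
qed

lemma integral_Cauchy_Schwarz_sqrt:
  assumes "L2 M f" "L2 M g"
  shows "\<bar>LINT x|M. f x * g x\<bar> \<le> sqrt ((LINT x|M. (f x)\<^sup>2) * (LINT x|M. (g x)\<^sup>2))"
  using real_sqrt_le_mono[OF integral_Cauchy_Schwarz[OF assms]] by simp

lemma (in prob_space) covar_eq:
  assumes "L2 M f" "L2 M g"
  shows "covar M f g = (LINT x|M. f x * g x) - (LINT x|M. f x) * (LINT x|M. g x)"
proof -
  have "covar M f g = (LINT x|M. f x * g x - (LINT y|M. g y) * f x - (LINT y|M. f y) * g x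
      + (LINT y|M. f y) * (LINT y|M. g y))"
    unfolding covar_def by (rule Bochner_Integration.integral_cong) (auto simp: algebra_simps)
  then show ?thesis
    using L2_mult_integrable[OF assms] L2_integrable[OF assms(1)] L2_integrable[OF assms(2)]
    by (simp add: prob_space algebra_simps)
qed

text \<open>Write \<open>h k - f g\<close> as
  \<open>(h - f) (k - g) + (h - f) g + f (k - g)\<close>; Cauchy-Schwarz then bounds each term by
  norms of the errors and of the fixed limits only.\<close>

lemma L2_tendsto_mult:
  assumes f: "L2 M f" "\<And>n. L2 M (h n)" "(\<lambda>n. LINT x|M. (h n x - f x)\<^sup>2) \<longlonglongrightarrow> 0"
    and g: "L2 M g" "\<And>n. L2 M (k n)" "(\<lambda>n. LINT x|M. (k n x - g x)\<^sup>2) \<longlonglongrightarrow> 0"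
  shows "(\<lambda>n. LINT x|M. h n x * k n x) \<longlonglongrightarrow> (LINT x|M. f x * g x)"
proof (rule LIM_zero_cancel, rule Lim_null_comparison)
  define a b where "a n = (LINT x|M. (h n x - f x)\<^sup>2)" and "b n = (LINT x|M. (k n x - g x)\<^sup>2)" for n
  define F G where "F = (LINT x|M. (f x)\<^sup>2)" and "G = (LINT x|M. (g x)\<^sup>2)"
  have "\<bar>(LINT x|M. h n x * k n x) - (LINT x|M. f x * g x)\<bar>
      \<le> sqrt (a n * b n) + sqrt (a n * G) + sqrt (F * b n)" for n
  proof -
    have d: "L2 M (\<lambda>x. h n x - f x)" "L2 M (\<lambda>x. k n x - g x)"
      using f g by (auto intro: L2_diff)
    have "(LINT x|M. h n x * k n x) - (LINT x|M. f x * g x) = (LINT x|M. h n x * k n x - f x * g x)"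
      using L2_mult_integrable[OF f(2) g(2)] L2_mult_integrable[OF f(1) g(1)] by simp
    also have "\<dots> = (LINT x|M. (h n x - f x) * (k n x - g x) + (h n x - f x) * g x
        + f x * (k n x - g x))"
      by (rule Bochner_Integration.integral_cong) (auto simp: algebra_simps)
    also have "\<dots> = (LINT x|M. (h n x - f x) * (k n x - g x)) + (LINT x|M. (h n x - f x) * g x)
        + (LINT x|M. f x * (k n x - g x))"
      using L2_mult_integrable[OF d] L2_mult_integrable[OF d(1) g(1)] L2_mult_integrable[OF f(1) d(2)]
      by simp
    finally show ?thesis
      using integral_Cauchy_Schwarz_sqrt[OF d] integral_Cauchy_Schwarz_sqrt[OF d(1) g(1)]
        integral_Cauchy_Schwarz_sqrt[OF f(1) d(2)]
      unfolding a_def b_def F_def G_def by linarith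
  qed
  then show "\<forall>\<^sub>F n in sequentially. norm ((LINT x|M. h n x * k n x) - (LINT x|M. f x * g x))
      \<le> sqrt (a n * b n) + sqrt (a n * G) + sqrt (F * b n)"
    by simp
  have "a \<longlonglongrightarrow> 0" "b \<longlonglongrightarrow> 0"
    using f(3) g(3) by (simp_all add: a_def[abs_def] b_def[abs_def])
  then have "(\<lambda>n. sqrt (a n * b n) + sqrt (a n * G) + sqrt (F * b n))
      \<longlonglongrightarrow> sqrt (0 * 0) + sqrt (0 * G) + sqrt (F * 0)"
    by (intro tendsto_intros)
  then show "(\<lambda>n. sqrt (a n * b n) + sqrt (a n * G) + sqrt (F * b n)) \<longlonglongrightarrow> 0"
    by simp
qed

section \<open>Closure in mean square\<close>

text \<open>The integral of a non-integrable function is 0, so membership is meaningful only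
  together with \<open>L2 M f\<close>; the lemmas that depend on this assume it separately.\<close>

definition L2_closure :: "'a measure \<Rightarrow> ('a \<Rightarrow> real) set \<Rightarrow> ('a \<Rightarrow> real) set" where
  "L2_closure M C = {f. \<forall>e>0. \<exists>h\<in>C. (LINT x|M. (h x - f x)\<^sup>2) < e}"

lemma L2_closure_sequence:
  assumes "f \<in> L2_closure M C"
  obtains h where "\<And>n::nat. h n \<in> C" "(\<lambda>n. LINT x|M. (h n x - f x)\<^sup>2) \<longlonglongrightarrow> 0"
proof -
  have "\<exists>h. h \<in> C \<and> (LINT x|M. (h x - f x)\<^sup>2) < inverse (real (Suc n))" for n
    using assms unfolding L2_closure_def
    by (auto dest!: spec[of _ "inverse (real (Suc n))"])
  then obtain h where h: "\<And>n::nat. h n \<in> C" "\<And>n. (LINT x|M. (h n x - f x)\<^sup>2) < inverse (real (Suc n))"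
    by metis
  have "(\<lambda>n. LINT x|M. (h n x - f x)\<^sup>2) \<longlonglongrightarrow> 0"
    by (rule tendsto_sandwich[OF _ _ tendsto_const LIMSEQ_inverse_real_of_nat])
      (use h(2) in \<open>auto intro: less_imp_le always_eventually\<close>)
  with h(1) that show thesis by blast
qed

text \<open>Covariance is jointly continuous in mean square, so both sides of the inequality pass to
  the limit.\<close>

lemma (in prob_space) covar_bound_L2_closure:
  assumes C: "\<And>h. h \<in> C \<Longrightarrow> L2 M h" and D: "\<And>h. h \<in> D \<Longrightarrow> L2 M h"
    and bound: "\<And>h k. h \<in> C \<Longrightarrow> k \<in> D \<Longrightarrow>
      \<bar>covar M h k\<bar> \<le> r * sqrt (covar M h h * covar M k k)"
    and f: "L2 M f" "f \<in> L2_closure M C" and g: "L2 M g" "g \<in> L2_closure M D"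
  shows "\<bar>covar M f g\<bar> \<le> r * sqrt (covar M f f * covar M g g)"
proof -
  obtain h where h: "\<And>n::nat. h n \<in> C" "(\<lambda>n. LINT x|M. (h n x - f x)\<^sup>2) \<longlonglongrightarrow> 0"
    using L2_closure_sequence[OF f(2)] by blast
  obtain k where k: "\<And>n::nat. k n \<in> D" "(\<lambda>n. LINT x|M. (k n x - g x)\<^sup>2) \<longlonglongrightarrow> 0"
    using L2_closure_sequence[OF g(2)] by blast
  \<comment> \<open>Pairing with the constant sequence 1 turns convergence of products into
    convergence of means.\<close>
  have one: "L2 M (\<lambda>_. 1)" "\<And>n::nat. L2 M (\<lambda>_. 1)" "(\<lambda>n::nat. LINT x|M. (1 - 1 :: real)\<^sup>2) \<longlonglongrightarrow> 0"
    by (auto intro: L2_const)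
  have lim: "(\<lambda>n. covar M (u n) (v n)) \<longlonglongrightarrow> covar M u' v'"
    if u: "L2 M u'" "\<And>n. L2 M (u n)" "(\<lambda>n. LINT x|M. (u n x - u' x)\<^sup>2) \<longlonglongrightarrow> 0"
      and v: "L2 M v'" "\<And>n. L2 M (v n)" "(\<lambda>n. LINT x|M. (v n x - v' x)\<^sup>2) \<longlonglongrightarrow> 0" for u v u' v'
  proof -
    have "(\<lambda>n. LINT x|M. u n x) \<longlonglongrightarrow> (LINT x|M. u' x)" "(\<lambda>n. LINT x|M. v n x) \<longlonglongrightarrow> (LINT x|M. v' x)"
      using L2_tendsto_mult[OF u one] L2_tendsto_mult[OF v one] by simp_all
    then show ?thesis
      using L2_tendsto_mult[OF u v] u v by (simp add: covar_eq tendsto_intros)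
  qed
  have h': "\<And>n. L2 M (h n)" and k': "\<And>n. L2 M (k n)" using h k C D by auto
  show ?thesis
  proof (rule LIMSEQ_le)
    show "(\<lambda>n. \<bar>covar M (h n) (k n)\<bar>) \<longlonglongrightarrow> \<bar>covar M f g\<bar>"
      by (intro tendsto_intros lim f g h h' k k')
    show "(\<lambda>n. r * sqrt (covar M (h n) (h n) * covar M (k n) (k n)))
        \<longlonglongrightarrow> r * sqrt (covar M f f * covar M g g)"
      by (intro tendsto_intros lim f g h h' k k')
  qed (use bound h k in blast)
qed

lemma L2_closure_superset: "C \<subseteq> L2_closure M C"
proof
  fix f assume "f \<in> C"
  then show "f \<in> L2_closure M C"
    unfolding L2_closure_def by (auto intro!: bexI[of _ f])
qed

lemma L2_norm_triangle:
  assumes "L2 M f" "L2 M g"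
  shows "(LINT x|M. (f x + g x)\<^sup>2) \<le> 2 * (LINT x|M. (f x)\<^sup>2) + 2 * (LINT x|M. (g x)\<^sup>2)"
proof -
  have "(LINT x|M. (f x + g x)\<^sup>2) \<le> (LINT x|M. 2 * (f x)\<^sup>2 + 2 * (g x)\<^sup>2)"
  proof (rule integral_mono)
    show "integrable M (\<lambda>x. (f x + g x)\<^sup>2)" using L2_add[OF assms] by (simp add: L2_def)
    show "integrable M (\<lambda>x. 2 * (f x)\<^sup>2 + 2 * (g x)\<^sup>2)" using assms by (simp add: L2_def)
    show "(f x + g x)\<^sup>2 \<le> 2 * (f x)\<^sup>2 + 2 * (g x)\<^sup>2" for x
      using zero_le_power2[of "f x - g x"] by (simp add: power2_sum power2_diff)
  qed
  also have "\<dots> = 2 * (LINT x|M. (f x)\<^sup>2) + 2 * (LINT x|M. (g x)\<^sup>2)"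
    using assms by (simp add: L2_def)
  finally show ?thesis .
qed

lemma L2_closure_closure:
  assumes C: "\<And>h. h \<in> C \<Longrightarrow> L2 M h" and f: "L2 M f"
    and u: "\<And>n::nat. L2 M (u n)" "\<And>n. u n \<in> L2_closure M C"
    and lim: "(\<lambda>n. LINT x|M. (u n x - f x)\<^sup>2) \<longlonglongrightarrow> 0"
  shows "f \<in> L2_closure M C"
  unfolding L2_closure_def
proof (intro CollectI allI impI)
  fix e :: real assume "0 < e"
  \<comment> \<open>A quarter for each of the two errors absorbs the factor 2 in
    \<open>L2_norm_triangle\<close>.\<close>
  then have "\<forall>\<^sub>F n in sequentially. (LINT x|M. (u n x - f x)\<^sup>2) < e / 4"
    by (intro order_tendstoD[OF lim]) auto
  then obtain n where n: "(LINT x|M. (u n x - f x)\<^sup>2) < e / 4"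
    by (auto dest: eventually_happens)
  from u(2)[of n] \<open>0 < e\<close> obtain h where h: "h \<in> C" "(LINT x|M. (h x - u n x)\<^sup>2) < e / 4"
    unfolding L2_closure_def by (auto dest: spec[of _ "e / 4"])
  have "(LINT x|M. ((h x - u n x) + (u n x - f x))\<^sup>2)
      \<le> 2 * (LINT x|M. (h x - u n x)\<^sup>2) + 2 * (LINT x|M. (u n x - f x)\<^sup>2)"
    by (rule L2_norm_triangle) (use h C u f in \<open>auto intro: L2_diff\<close>)
  also have "\<dots> < e" using n h by simp
  finally show "\<exists>h\<in>C. (LINT x|M. (h x - f x)\<^sup>2) < e" using h(1) by (auto intro!: bexI[of _ h])
qed

lemma L2_closure_add:
  assumes C: "\<And>h. h \<in> C \<Longrightarrow> L2 M h" and add: "\<And>h k. h \<in> C \<Longrightarrow> k \<in> C \<Longrightarrow> (\<lambda>x. h x + k x) \<in> C"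
    and f: "L2 M f" "f \<in> L2_closure M C" and g: "L2 M g" "g \<in> L2_closure M C"
  shows "(\<lambda>x. f x + g x) \<in> L2_closure M C"
  unfolding L2_closure_def
proof (intro CollectI allI impI)
  fix e :: real assume "0 < e"
  then obtain h k where hk: "h \<in> C" "(LINT x|M. (h x - f x)\<^sup>2) < e / 4"
      "k \<in> C" "(LINT x|M. (k x - g x)\<^sup>2) < e / 4"
    using f(2) g(2) unfolding L2_closure_def by (auto dest!: spec[of _ "e / 4"])
  have "(LINT x|M. ((h x - f x) + (k x - g x))\<^sup>2)
      \<le> 2 * (LINT x|M. (h x - f x)\<^sup>2) + 2 * (LINT x|M. (k x - g x)\<^sup>2)"
    by (rule L2_norm_triangle) (use hk C f g in \<open>auto intro: L2_diff\<close>)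
  also have "\<dots> < e" using hk by simp
  finally show "\<exists>h\<in>C. (LINT x|M. (h x - (f x + g x))\<^sup>2) < e"
    using add[OF hk(1,3)] by (intro bexI[of _ "\<lambda>x. h x + k x"]) (auto simp: algebra_simps)
qed

lemma L2_closure_scale:
  assumes scale: "\<And>h. h \<in> C \<Longrightarrow> (\<lambda>x. c * h x) \<in> C"
    and f: "f \<in> L2_closure M C"
  shows "(\<lambda>x. c * f x) \<in> L2_closure M C"
  unfolding L2_closure_def
proof (intro CollectI allI impI)
  fix e :: real assume "0 < e"
  \<comment> \<open>The summand 1 keeps the denominator positive when \<open>c = 0\<close>.\<close>
  then have "0 < e / (c\<^sup>2 + 1)" by (intro divide_pos_pos) (auto simp: add_nonneg_pos)
  then obtain h where h: "h \<in> C" "(LINT x|M. (h x - f x)\<^sup>2) < e / (c\<^sup>2 + 1)"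
    using f unfolding L2_closure_def by auto
  have "(LINT x|M. (c * h x - c * f x)\<^sup>2) = c\<^sup>2 * (LINT x|M. (h x - f x)\<^sup>2)"
    by (simp flip: right_diff_distrib add: power_mult_distrib)
  also have "\<dots> \<le> (c\<^sup>2 + 1) * (LINT x|M. (h x - f x)\<^sup>2)"
    by (intro mult_right_mono) auto
  also have "\<dots> < e"
    using h(2) by (simp add: pos_less_divide_eq add_nonneg_pos mult.commute)
  finally show "\<exists>h\<in>C. (LINT x|M. (h x - c * f x)\<^sup>2) < e"
    using scale[OF h(1)] by (intro bexI[of _ "\<lambda>x. c * h x"]) auto
qed

section \<open>Density in the L2 functions of a generated sigma-field\<close>

text \<open>The sets whose indicators lie in the closure form a Dynkin system: complements use the
  constant 1, disjoint unions use partial sums of indicators and dominated convergence.\<close>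

lemma (in finite_measure) L2_closure_indicator:
  assumes C: "\<And>h. h \<in> C \<Longrightarrow> L2 M h"
    and add: "\<And>h k. h \<in> C \<Longrightarrow> k \<in> C \<Longrightarrow> (\<lambda>x. h x + k x) \<in> C"
    and scale: "\<And>h c. h \<in> C \<Longrightarrow> (\<lambda>x. c * h x) \<in> C"
    and const: "\<And>c. (\<lambda>x. c) \<in> C"
    and G: "Int_stable G" "G \<subseteq> sets M" "\<And>A. A \<in> G \<Longrightarrow> (indicator A :: _ \<Rightarrow> real) \<in> C"
    and A: "A \<in> sigma_sets (space M) G"
  shows "(indicator A :: _ \<Rightarrow> real) \<in> L2_closure M C"
proof -
  have Gs: "G \<subseteq> Pow (space M)" using G(2) sets.space_closed by blast
  have GM: "B \<in> sets M" if "B \<in> sigma_sets (space M) G" for B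
    using that G(2) sets.sigma_sets_subset[of G M] by blast
  have L2i: "L2 M (indicator B :: _ \<Rightarrow> real)" if "B \<in> sets M" for B
    using that by (intro L2_bounded[of _ 1]) (auto simp: indicator_def)
  from G(1) Gs A show ?thesis
  proof (induction rule: sigma_sets_induct_disjoint)
    case (basic B)
    then show ?case using G(3) L2_closure_superset by blast
  next
    case empty
    show ?case using const[of 0] L2_closure_superset by (force simp: indicator_def)
  next
    case (compl B)
    have "(\<lambda>x. 1 + (-1) * indicator B x) \<in> L2_closure M C"
      using compl L2i[OF GM[OF compl(1)]] const[of 1] L2_closure_superset
      by (intro L2_closure_add[OF C add] L2_closure_scale scale L2_const L2_scale) auto
    moreover have "(indicator (space M - B) x :: real) = 1 + (-1) * indicator B x" if "x \<in> space M" for x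
      using that by (auto simp: indicator_def)
    ultimately show ?case unfolding L2_closure_def
      by (simp cong: Bochner_Integration.integral_cong)
  next
    case (union B)
    define u where "u n = (\<lambda>x. \<Sum>i<n. indicator (B i) x :: real)" for n
    have BM: "B i \<in> sets M" for i using union(2) GM by auto
    have u: "u n \<in> L2_closure M C \<and> L2 M (u n)" for n
    proof (induction n)
      case 0
      then show ?case using const[of 0] L2_closure_superset L2_const[of 0] by (force simp: u_def)
    next
      case (Suc n)
      have "(\<lambda>x. u n x + indicator (B n) x) \<in> L2_closure M C"
        using Suc union(3) L2i[OF BM] by (intro L2_closure_add[OF C add]) auto
      moreover have "L2 M (\<lambda>x. u n x + indicator (B n) x)"
        using Suc L2i[OF BM] by (intro L2_add) auto
      ultimately show ?case by (simp add: u_def)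
    qed
    have u_ind: "u n x = indicator (\<Union>i<n. B i) x" for n x
      unfolding u_def using union(1)
      by (subst indicator_UN_disjoint) (auto simp: disjoint_family_on_def)
    show ?case
    proof (rule L2_closure_closure[OF C])
      show "(\<lambda>n. LINT x|M. (u n x - indicator (\<Union> (range B)) x)\<^sup>2) \<longlonglongrightarrow> 0"
      proof -
        have "(\<lambda>n. LINT x|M. (u n x - indicator (\<Union> (range B)) x)\<^sup>2) \<longlonglongrightarrow> (LINT x|M. 0)"
        proof (rule integral_dominated_convergence[where w = "\<lambda>_. 1"])
          have *: "(\<lambda>n. u n x) \<longlonglongrightarrow> indicator (\<Union> (range B)) x" for x
            unfolding u_ind by (rule LIMSEQ_indicator_UN)
          show "AE x in M. (\<lambda>n. (u n x - indicator (\<Union> (range B)) x)\<^sup>2) \<longlonglongrightarrow> 0"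
            using tendsto_power[OF LIM_zero[OF *], where n = 2] by simp
          show "AE x in M. norm ((u n x - indicator (\<Union> (range B)) x)\<^sup>2) \<le> 1" for n
            by (auto simp: u_ind indicator_def)
        next
          show "(\<lambda>x. (u n x - indicator (\<Union> (range B)) x)\<^sup>2) \<in> borel_measurable M" for n
            using u[of n] BM by (auto simp: L2_def intro!: borel_measurable_power borel_measurable_diff
                borel_measurable_indicator)
        qed auto
        then show ?thesis by simp
      qed
    qed (use u BM L2i in auto)
  qed
qed

text \<open>Monotone approximation by simple functions. The majorant \<open>f\<close> makes every
  intermediate function square-integrable and also dominates the squared errors.\<close>

lemma (in finite_measure) L2_closure_nonneg:
  assumes C: "\<And>h. h \<in> C \<Longrightarrow> L2 M h"
    and add: "\<And>h k. h \<in> C \<Longrightarrow> k \<in> C \<Longrightarrow> (\<lambda>x. h x + k x) \<in> C"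
    and scale: "\<And>h c. h \<in> C \<Longrightarrow> (\<lambda>x. c * h x) \<in> C"
    and ind: "\<And>A. A \<in> sets B \<Longrightarrow> (indicator A :: _ \<Rightarrow> real) \<in> L2_closure M C"
    and sub: "space B = space M" "sets B \<subseteq> sets M"
    and f: "f \<in> borel_measurable B" "L2 M f" "\<And>x. 0 \<le> f x"
  shows "f \<in> L2_closure M C"
proof -
  have BM: "u \<in> borel_measurable M" if "u \<in> borel_measurable B" for u :: "'a \<Rightarrow> real"
    using that sub by (auto simp: measurable_def)
  have dom: "L2 M u" if "u \<in> borel_measurable B" "L2 M v" "\<And>x. x \<in> space M \<Longrightarrow> 0 \<le> u x"
    "\<And>x. x \<in> space M \<Longrightarrow> u x \<le> v x" for u v
    unfolding L2_def
  proof
    show "integrable M (\<lambda>x. (u x)\<^sup>2)"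
    proof (rule Bochner_Integration.integrable_bound[OF L2_square[OF that(2)]])
      show "AE x in M. norm ((u x)\<^sup>2) \<le> norm ((v x)\<^sup>2)"
        using that(3,4) by (intro AE_I2) (simp add: power_mono)
      show "(\<lambda>x. (u x)\<^sup>2) \<in> borel_measurable M"
        using BM[OF that(1)] by measurable
    qed
  qed (rule BM[OF that(1)])
  from f(1,3,2) show ?thesis
  proof (induction rule: borel_measurable_induct_real)
    case (set A)
    then show ?case by (intro ind)
  next
    case (mult u c)
    show ?case
    \<comment> \<open>Square-integrability passes from \<open>c * u\<close> to \<open>u\<close> only
      for nonzero \<open>c\<close>; otherwise the product is the indicator of the empty set.\<close>
    proof (cases "c = 0")
      case True
      have "indicator {} \<in> L2_closure M C" by (intro ind) auto
      then show ?thesis using True by (simp add: indicator_def[abs_def])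
    next
      case False
      then have "L2 M u" using L2_scale[OF mult.prems, of "1 / c"] by simp
      then show ?thesis using mult by (intro L2_closure_scale scale)
    qed
  next
    case (add u v)
    have "L2 M u" "L2 M v" using add by (auto intro!: dom[OF _ add.prems])
    then show ?case using add by (intro L2_closure_add[OF C assms(2)])
  next
    case (seq U)
    have le: "U i x \<le> f x" if "x \<in> space M" for i x
      using seq that sub by (intro incseq_le[of "\<lambda>i. U i x"]) (auto simp: incseq_def le_fun_def)
    then have L: "L2 M (U i)" for i
      using seq by (intro dom[OF _ seq.prems]) auto
    have nn: "0 \<le> f x" if "x \<in> space M" for x
      using le[OF that, of 0] seq(2)[of 0 x] by simp
    show ?case
    proof (rule L2_closure_closure[OF C seq.prems L])
      have "(\<lambda>n. LINT x|M. (U n x - f x)\<^sup>2) \<longlonglongrightarrow> (LINT x|M. 0)"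
      proof (rule integral_dominated_convergence[where w = "\<lambda>x. (f x)\<^sup>2"])
        show "AE x in M. (\<lambda>n. (U n x - f x)\<^sup>2) \<longlonglongrightarrow> 0"
        proof (rule AE_I2)
          fix x assume "x \<in> space M"
          then have "(\<lambda>n. U n x) \<longlonglongrightarrow> f x" using seq sub by auto
          then show "(\<lambda>n. (U n x - f x)\<^sup>2) \<longlonglongrightarrow> 0"
            using tendsto_power[OF LIM_zero, of "\<lambda>n. U n x" "f x" sequentially 2] by simp
        qed
        show "AE x in M. norm ((U n x - f x)\<^sup>2) \<le> (f x)\<^sup>2" for n
        proof (rule AE_I2)
          fix x assume "x \<in> space M"
          then have "0 \<le> f x - U n x" "f x - U n x \<le> f x" using le seq(2)[of n x] by auto
          then show "norm ((U n x - f x)\<^sup>2) \<le> (f x)\<^sup>2"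
            using power_mono[of "f x - U n x" "f x" 2] by (simp add: power2_commute)
        qed
      next
        show "(\<lambda>x. (U n x - f x)\<^sup>2) \<in> borel_measurable M" for n
          using L2_D[OF L[of n]] L2_D[OF seq.prems] by measurable
      qed (use L2_square[OF seq.prems] in auto)
      then show "(\<lambda>n. LINT x|M. (U n x - f x)\<^sup>2) \<longlonglongrightarrow> 0" by simp
    qed (use seq L in auto)
  qed
qed

text \<open>Positive and negative parts reduce this to nonnegative functions. It is the density
  statement through which bounds for functions of finitely many clusters reach all L2
  functions.\<close>

lemma (in finite_measure) L2_closure_sigma:
  assumes C: "\<And>h. h \<in> C \<Longrightarrow> L2 M h"
    and add: "\<And>h k. h \<in> C \<Longrightarrow> k \<in> C \<Longrightarrow> (\<lambda>x. h x + k x) \<in> C"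
    and scale: "\<And>h c. h \<in> C \<Longrightarrow> (\<lambda>x. c * h x) \<in> C"
    and const: "\<And>c. (\<lambda>x. c) \<in> C"
    and G: "Int_stable G" "G \<subseteq> sets M" "\<And>A. A \<in> G \<Longrightarrow> (indicator A :: _ \<Rightarrow> real) \<in> C"
    and f: "f \<in> borel_measurable (sigma (space M) G)" "L2 M f"
  shows "f \<in> L2_closure M C"
proof -
  have Gs: "G \<subseteq> Pow (space M)" using G(2) sets.space_closed by blast
  let ?B = "sigma (space M) G"
  have sub: "space ?B = space M" "sets ?B \<subseteq> sets M"
    using Gs G(2) sets.sigma_sets_subset[of G M] by auto
  have ind: "(indicator A :: _ \<Rightarrow> real) \<in> L2_closure M C" if "A \<in> sets ?B" for A
  proof (rule L2_closure_indicator[OF C add scale const G])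
    show "A \<in> sigma_sets (space M) G" using that Gs by simp
  qed
  have BM: "u \<in> borel_measurable M" if "u \<in> borel_measurable ?B" for u :: "'a \<Rightarrow> real"
    using that sub by (auto simp: measurable_def)
  \<comment> \<open>The values 1 and -1 of \<open>c\<close> give the positive and the negative
    part.\<close>
  have part: "L2 M (\<lambda>x. max 0 (c * f x))" "(\<lambda>x. max 0 (c * f x)) \<in> L2_closure M C" for c
  proof -
    show *: "L2 M (\<lambda>x. max 0 (c * f x))"
      unfolding L2_def
    proof
      show "integrable M (\<lambda>x. (max 0 (c * f x))\<^sup>2)"
      proof (rule Bochner_Integration.integrable_bound[OF L2_square[OF L2_scale[OF f(2), of c]]])
        show "(\<lambda>x. (max 0 (c * f x))\<^sup>2) \<in> borel_measurable M"
          using BM[OF f(1)] by measurable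
      qed (simp add: max_def)
      show "(\<lambda>x. max 0 (c * f x)) \<in> borel_measurable M"
        using BM[OF f(1)] by measurable
    qed
    show "(\<lambda>x. max 0 (c * f x)) \<in> L2_closure M C"
    proof (rule L2_closure_nonneg[OF C add scale ind sub _ *])
      show "(\<lambda>x. max 0 (c * f x)) \<in> borel_measurable ?B"
        using f(1) by measurable
    qed auto
  qed
  have "(\<lambda>x. max 0 (1 * f x) + (-1) * max 0 ((-1) * f x)) \<in> L2_closure M C"
    by (intro L2_closure_add[OF C add] L2_closure_scale scale L2_scale part)
  moreover have "max 0 (1 * y) + (-1) * max 0 ((-1) * y) = y" for y :: real by auto
  ultimately show ?thesis by simp
qed

section \<open>Maximal correlation of finite clusters\<close>

lemma L2_finite_pmf: "finite (set_pmf p) \<Longrightarrow> L2 (measure_pmf p) f"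
  unfolding L2_def by (auto intro: integrable_measure_pmf_finite)

lemma expectation_pair_pmf_finite:
  fixes h :: "_ \<Rightarrow> real"
  assumes "finite (set_pmf p)" "finite (set_pmf q)"
  shows "measure_pmf.expectation (pair_pmf p q) h =
    measure_pmf.expectation q (\<lambda>b. measure_pmf.expectation p (\<lambda>a. h (a, b)))"
proof -
  have "measure_pmf.expectation (pair_pmf p q) h =
      (\<Sum>x\<in>set_pmf p \<times> set_pmf q. h x * pmf (pair_pmf p q) x)"
    using assms by (intro integral_measure_pmf_real) auto
  also have "\<dots> = (\<Sum>a\<in>set_pmf p. \<Sum>b\<in>set_pmf q. h (a, b) * (pmf p a * pmf q b))"
    by (simp add: sum.cartesian_product pmf_pair case_prod_unfold cong: sum.cong)
      (auto intro!: sum.cong simp: pmf_pair)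
  also have "\<dots> = (\<Sum>b\<in>set_pmf q. (\<Sum>a\<in>set_pmf p. h (a, b) * pmf p a) * pmf q b)"
    by (subst sum.swap) (simp add: sum_distrib_right sum_distrib_left mult_ac)
  also have "\<dots> = measure_pmf.expectation q (\<lambda>b. measure_pmf.expectation p (\<lambda>a. h (a, b)))"
    using assms by (simp add: integral_measure_pmf_real[of "set_pmf p"] integral_measure_pmf_real[of "set_pmf q"])
  finally show ?thesis .
qed

section \<open>Tensorization of covariance bounds\<close>

text \<open>For finitely supported \<open>p\<close> and \<open>r \<ge> 0\<close> this says that the
  maximal correlation between the observations \<open>u\<close> and \<open>w\<close> is at most
  \<open>r\<close>; the product form avoids dividing by a vanishing variance.\<close>

definition views_bound :: "'a pmf \<Rightarrow> ('a \<Rightarrow> 'x) \<Rightarrow> ('a \<Rightarrow> 'y) \<Rightarrow> real \<Rightarrow> bool" where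
  "views_bound p u w r \<longleftrightarrow> (\<forall>f g. \<bar>covar (measure_pmf p) (f \<circ> u) (g \<circ> w)\<bar> \<le>
     r * sqrt (covar (measure_pmf p) (f \<circ> u) (f \<circ> u) * covar (measure_pmf p) (g \<circ> w) (g \<circ> w)))"

lemma covar_self_nonneg: "0 \<le> covar M f f"
  unfolding covar_def by simp

text \<open>Cauchy-Schwarz in the plane for the vectors of square roots. It recombines the two terms
  of a conditional decomposition of covariance without loss in the constant.\<close>

lemma sqrt_sum_Cauchy_Schwarz:
  fixes a b c d :: real
  assumes "0 \<le> a" "0 \<le> b" "0 \<le> c" "0 \<le> d"
  shows "sqrt (a * b) + sqrt (c * d) \<le> sqrt ((a + c) * (b + d))"
proof (rule real_le_rsqrt)
  define x y z w where "x = sqrt a" and "y = sqrt b" and "z = sqrt c" and "w = sqrt d"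
  have sq: "a = x\<^sup>2" "b = y\<^sup>2" "c = z\<^sup>2" "d = w\<^sup>2"
    using assms by (simp_all add: x_def y_def z_def w_def)
  have "0 \<le> (x * w - y * z)\<^sup>2" by simp
  then have "(x * y + z * w)\<^sup>2 \<le> (a + c) * (b + d)"
    unfolding sq by (simp add: power2_eq_square algebra_simps)
  then show "(sqrt (a * b) + sqrt (c * d))\<^sup>2 \<le> (a + c) * (b + d)"
    by (simp add: x_def y_def z_def w_def real_sqrt_mult)
qed

text \<open>Maximal correlation tensorizes (Csaki and Fischer): condition on the second coordinate.\<close>

lemma views_bound_pair:
  fixes p :: "'a pmf" and q :: "'b pmf" and u :: "'a \<Rightarrow> 'c" and w :: "'a \<Rightarrow> 'd"
    and u' :: "'b \<Rightarrow> 'e" and w' :: "'b \<Rightarrow> 'f"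
  assumes fin: "finite (set_pmf p)" "finite (set_pmf q)" and r: "0 \<le> r"
    and p: "views_bound p u w r" and q: "views_bound q u' w' r"
  shows "views_bound (pair_pmf p q) (map_prod u u') (map_prod w w') r"
  unfolding views_bound_def
proof (intro allI)
  fix f :: "'c \<times> 'e \<Rightarrow> real" and g :: "'d \<times> 'f \<Rightarrow> real"
  let ?E = "measure_pmf.expectation p" and ?E' = "measure_pmf.expectation q"
  let ?pq = "pair_pmf p q"
  define F where "F = f \<circ> map_prod u u'"
  define G where "G = g \<circ> map_prod w w'"
  have finpq: "finite (set_pmf ?pq)" using fin by simp
  define m where "m h b = ?E (\<lambda>a. h (a, b))" for h :: "'a \<times> 'b \<Rightarrow> real" and b
  define v where "v h k b = covar p (\<lambda>a. h (a, b)) (\<lambda>a. k (a, b))" for h k :: "'a \<times> 'b \<Rightarrow> real" and b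
  \<comment> \<open>Law of total covariance: the mean of the conditional covariances plus the
    covariance of the conditional means.\<close>
  have dec: "covar ?pq h k = ?E' (v h k) + covar q (m h) (m k)" for h k
  proof -
    have "v h k = (\<lambda>b. ?E (\<lambda>a. h (a, b) * k (a, b)) - m h b * m k b)"
      unfolding v_def m_def using fin by (simp add: measure_pmf.covar_eq L2_finite_pmf)
    then have "?E' (v h k) = ?E' (\<lambda>b. ?E (\<lambda>a. h (a, b) * k (a, b))) - ?E' (\<lambda>b. m h b * m k b)"
      using fin by (simp add: integrable_measure_pmf_finite)
    then show ?thesis
      using fin finpq
      by (simp add: measure_pmf.covar_eq L2_finite_pmf expectation_pair_pmf_finite m_def)
  qed
  \<comment> \<open>For fixed \<open>b\<close>, both functions depend on the first coordinate only
    through \<open>u\<close> and \<open>w\<close>.\<close>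
  have vb: "\<bar>v F G b\<bar> \<le> r * sqrt (v F F b * v G G b)" for b
    using p[unfolded views_bound_def, rule_format, of "\<lambda>x. f (x, u' b)" "\<lambda>y. g (y, w' b)"]
    by (simp add: v_def F_def G_def comp_def)
  have vnn: "0 \<le> v h h b" for h b unfolding v_def by (rule covar_self_nonneg)
  have "\<bar>?E' (v F G)\<bar> \<le> ?E' (\<lambda>b. \<bar>v F G b\<bar>)"
    using integral_norm_bound[of "measure_pmf q" "v F G"] by simp
  also have "\<dots> \<le> ?E' (\<lambda>b. r * (sqrt (v F F b) * sqrt (v G G b)))"
    using vb fin by (intro integral_mono integrable_measure_pmf_finite) (auto simp: real_sqrt_mult)
  also have "\<dots> = r * ?E' (\<lambda>b. sqrt (v F F b) * sqrt (v G G b))" by simp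
  also have "\<dots> \<le> r * sqrt (?E' (v F F) * ?E' (v G G))"
  proof (rule mult_left_mono[OF _ r])
    have "\<bar>?E' (\<lambda>b. sqrt (v F F b) * sqrt (v G G b))\<bar>
        \<le> sqrt (?E' (\<lambda>b. (sqrt (v F F b))\<^sup>2) * ?E' (\<lambda>b. (sqrt (v G G b))\<^sup>2))"
      using fin by (intro integral_Cauchy_Schwarz_sqrt L2_finite_pmf)
    then show "?E' (\<lambda>b. sqrt (v F F b) * sqrt (v G G b)) \<le> sqrt (?E' (v F F) * ?E' (v G G))"
      using vnn by simp
  qed
  finally have 1: "\<bar>?E' (v F G)\<bar> \<le> r * sqrt (?E' (v F F) * ?E' (v G G))" .
  \<comment> \<open>The conditional means depend on the second coordinate only through its views
    \<open>u'\<close> and \<open>w'\<close>, so the bound for \<open>q\<close> applies to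
    them.\<close>
  have 2: "\<bar>covar q (m F) (m G)\<bar> \<le> r * sqrt (covar q (m F) (m F) * covar q (m G) (m G))"
    using q[unfolded views_bound_def, rule_format, of "\<lambda>y. ?E (\<lambda>a. f (u a, y))" "\<lambda>y. ?E (\<lambda>a. g (w a, y))"]
    by (simp add: m_def [abs_def] F_def G_def comp_def)
  have "\<bar>covar ?pq F G\<bar> \<le> r * (sqrt (?E' (v F F) * ?E' (v G G))
      + sqrt (covar q (m F) (m F) * covar q (m G) (m G)))"
    unfolding dec using 1 2 by (simp add: algebra_simps)
  also have "\<dots> \<le> r * sqrt (covar ?pq F F * covar ?pq G G)"
    unfolding dec
    by (intro mult_left_mono r sqrt_sum_Cauchy_Schwarz covar_self_nonneg Bochner_Integration.integral_nonneg vnn)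
  finally show "\<bar>covar ?pq F G\<bar> \<le> r * sqrt (covar ?pq F F * covar ?pq G G)" .
qed

lemma covar_map_pmf: "covar (measure_pmf (map_pmf h p)) f g = covar (measure_pmf p) (f \<circ> h) (g \<circ> h)"
  unfolding covar_def by (simp add: comp_def)

text \<open>Induction on the index set: \<open>Pi_pmf_insert\<close> presents the larger product as
  the image of a pair, to which the two-factor bound applies.\<close>

lemma views_bound_Pi_pmf:
  assumes "finite F" and fin: "\<And>c. c \<in> F \<Longrightarrow> finite (set_pmf (p c))" and r: "0 \<le> r"
    and p: "\<And>c. c \<in> F \<Longrightarrow> views_bound (p c) (u c) (w c) r"
  shows "views_bound (Pi_pmf F dflt p) (\<lambda>x c. if c \<in> F then u c (x c) else du)
    (\<lambda>x c. if c \<in> F then w c (x c) else dw) r"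
  using assms(1) fin p
proof (induction F)
  case empty
  then show ?case
    using r by (simp add: views_bound_def covar_def)
next
  case (insert c F)
  let ?q = "Pi_pmf F dflt p"
  have "finite (set_pmf ?q)"
    using insert by (subst set_Pi_pmf) (auto intro!: finite_PiE_dflt)
  then have "views_bound (pair_pmf (p c) ?q)
      (map_prod (u c) (\<lambda>x c. if c \<in> F then u c (x c) else du))
      (map_prod (w c) (\<lambda>x c. if c \<in> F then w c (x c) else dw)) r"
    using insert by (intro views_bound_pair r) auto
  then have B: "\<bar>covar (pair_pmf (p c) ?q) (f \<circ> map_prod (u c) (\<lambda>x c. if c \<in> F then u c (x c) else du))
        (g \<circ> map_prod (w c) (\<lambda>x c. if c \<in> F then w c (x c) else dw))\<bar> \<le>
      r * sqrt (covar (pair_pmf (p c) ?q) (f \<circ> map_prod (u c) (\<lambda>x c. if c \<in> F then u c (x c) else du))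
          (f \<circ> map_prod (u c) (\<lambda>x c. if c \<in> F then u c (x c) else du)) *
        covar (pair_pmf (p c) ?q) (g \<circ> map_prod (w c) (\<lambda>x c. if c \<in> F then w c (x c) else dw))
          (g \<circ> map_prod (w c) (\<lambda>x c. if c \<in> F then w c (x c) else dw)))" for f g
    unfolding views_bound_def by blast
  \<comment> \<open>Updating at \<open>c\<close> and then observing all coordinates is the same as
    observing the two components and then updating.\<close>
  have eq: "k \<circ> (\<lambda>x d. if d \<in> insert c F then s d (x d) else e) \<circ> (\<lambda>(y, x). x(c := y))
      = (\<lambda>(y, x). k (x(c := y))) \<circ> map_prod (s c) (\<lambda>x d. if d \<in> F then s d (x d) else e)"
    for k :: "('a \<Rightarrow> 'z) \<Rightarrow> real" and s :: "'a \<Rightarrow> 'b \<Rightarrow> 'z" and e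
  proof
    fix yx :: "'b \<times> ('a \<Rightarrow> 'b)"
    obtain y x where yx: "yx = (y, x)" by force
    have "(\<lambda>d. if d \<in> insert c F then s d ((x(c := y)) d) else e)
        = (\<lambda>d. if d \<in> F then s d (x d) else e)(c := s c y)"
      by auto
    then show "(k \<circ> (\<lambda>x d. if d \<in> insert c F then s d (x d) else e) \<circ> (\<lambda>(y, x). x(c := y))) yx
      = ((\<lambda>(y, x). k (x(c := y))) \<circ> map_prod (s c) (\<lambda>x d. if d \<in> F then s d (x d) else e)) yx"
      by (simp add: yx)
  qed
  show ?case
    unfolding views_bound_def Pi_pmf_insert[OF insert.hyps] covar_map_pmf eq
    using B by blast
qed

section \<open>The parity-biased law on subsets\<close>

lemma sum_Pow_Un:
  assumes "finite I" "finite J" "I \<inter> J = {}"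
  shows "(\<Sum>A\<in>Pow (I \<union> J). F (A \<inter> I) (A \<inter> J)) = (\<Sum>A\<in>Pow I. \<Sum>B\<in>Pow J. F A B)"
  unfolding sum.cartesian_product
  by (rule sum.reindex_bij_witness[where i = "\<lambda>(A, B). A \<union> B" and j = "\<lambda>A. (A \<inter> I, A \<inter> J)"])
    (use assms in \<open>auto intro!: arg_cong2[of _ _ _ _ F]\<close>)

text \<open>Expansion of the product over \<open>I\<close> of the vanishing factors
  \<open>-1 + 1\<close>.\<close>

lemma sum_Pow_sign:
  assumes "finite I" "I \<noteq> {}"
  shows "(\<Sum>A\<in>Pow I. (-1) ^ card A) = (0 :: real)"
  using prod_add[OF assms(1), of "\<lambda>_. -1 :: real" "\<lambda>_. 1"] assms
    by (simp add: power_0_left)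

text \<open>Conditioning fair coins on parity with bias \<open>\<kappa>\<close>: any proper subset of the coins stays independent.\<close>

definition parity_pmf :: "nat \<Rightarrow> real \<Rightarrow> nat set pmf" where
  "parity_pmf n \<kappa> = embed_pmf (\<lambda>A. if A \<subseteq> {..<n} then (1 + \<kappa> * (-1) ^ card A) / 2 ^ n else 0)"

locale parity_cluster =
  fixes n :: nat and \<kappa> :: real
  assumes n: "0 < n" and \<kappa>: "0 \<le> \<kappa>" "\<kappa> \<le> 1"
begin

lemma weight_nonneg: "0 \<le> (1 + \<kappa> * (-1) ^ k)"
  using \<kappa> by (cases "even k") auto

lemma pmf_parity:
  "pmf (parity_pmf n \<kappa>) A = (if A \<subseteq> {..<n} then (1 + \<kappa> * (-1) ^ card A) / 2 ^ n else 0)"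
  unfolding parity_pmf_def
proof (rule pmf_embed_pmf)
  let ?w = "\<lambda>A :: nat set. if A \<subseteq> {..<n} then (1 + \<kappa> * (-1) ^ card A) / 2 ^ n else 0"
  show nn: "0 \<le> ?w A" for A using weight_nonneg by simp
  have "(\<integral>\<^sup>+A. ennreal (?w A) \<partial>count_space UNIV) = (\<Sum>A\<in>Pow {..<n}. ennreal (?w A))"
    by (rule nn_integral_count_space'[of "Pow {..<n}"]) auto
  also have "\<dots> = ennreal (\<Sum>A\<in>Pow {..<n}. ?w A)"
    by (intro sum_ennreal nn)
  also have "(\<Sum>A\<in>Pow {..<n}. ?w A) = (\<Sum>A\<in>Pow {..<n}. (1 + \<kappa> * (-1) ^ card A) / 2 ^ n)"
    by (rule sum.cong) auto
  \<comment> \<open>The bias only moves mass from odd to even sets, so the total is that of fair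
    coins.\<close>
  also have "\<dots> = ((\<Sum>A\<in>Pow {..<n}. 1) + \<kappa> * (\<Sum>A\<in>Pow {..<n}. (-1) ^ card A)) / 2 ^ n"
    by (simp add: sum_divide_distrib[symmetric] sum.distrib sum_distrib_left)
  also have "\<dots> = 1"
    using n by (subst sum_Pow_sign) (auto simp: card_Pow)
  finally show "(\<integral>\<^sup>+A. ennreal (?w A) \<partial>count_space UNIV) = 1" by simp
qed

lemma set_pmf_parity: "set_pmf (parity_pmf n \<kappa>) \<subseteq> Pow {..<n}"
  by (auto simp: set_pmf_eq pmf_parity split: if_splits)

lemma finite_set_pmf_parity: "finite (set_pmf (parity_pmf n \<kappa>))"
  using set_pmf_parity by (rule finite_subset) simp

text \<open>Summing over the unobserved coins \<open>J\<close> cancels the parity term unless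
  \<open>J\<close> is empty. This is the source of the independence of every proper part.\<close>

lemma expectation_parity:
  assumes "I \<subseteq> {..<n}"
  shows "measure_pmf.expectation (parity_pmf n \<kappa>) (\<lambda>A. h (A \<inter> I)) =
    (\<Sum>A\<in>Pow I. h A * (1 + (if I = {..<n} then \<kappa> else 0) * (-1) ^ card A)) / 2 ^ card I"
proof -
  define J where "J = {..<n} - I"
  have IJ: "finite I" "finite J" "I \<inter> J = {}" "I \<union> J = {..<n}"
    using assms by (auto simp: J_def finite_subset)
  have cIJ: "card I + card J = n" using IJ card_Un_disjoint[of I J] by simp
  have "measure_pmf.expectation (parity_pmf n \<kappa>) (\<lambda>A. h (A \<inter> I)) =
      (\<Sum>A\<in>Pow {..<n}. h (A \<inter> I) * pmf (parity_pmf n \<kappa>) A)"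
    using set_pmf_parity by (intro integral_measure_pmf_real) auto
  also have "\<dots> = (\<Sum>A\<in>Pow (I \<union> J). h (A \<inter> I) * ((1 + \<kappa> * ((-1) ^ card (A \<inter> I) * (-1) ^ card (A \<inter> J))) / 2 ^ n))"
    unfolding IJ(4)
  proof (rule sum.cong)
    fix A assume "A \<in> Pow {..<n}"
    then have A: "A \<subseteq> {..<n}" "finite A" by (auto simp: finite_subset)
    have "card A = card (A \<inter> I) + card (A \<inter> J)"
      using IJ A by (subst card_Un_disjoint[symmetric]) (auto intro!: arg_cong[of _ _ card])
    then show "h (A \<inter> I) * pmf (parity_pmf n \<kappa>) A =
        h (A \<inter> I) * ((1 + \<kappa> * ((-1) ^ card (A \<inter> I) * (-1) ^ card (A \<inter> J))) / 2 ^ n)"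
      using A by (simp add: pmf_parity power_add)
  qed simp
  also have "\<dots> = (\<Sum>A\<in>Pow I. \<Sum>B\<in>Pow J. h A * ((1 + \<kappa> * ((-1) ^ card A * (-1) ^ card B)) / 2 ^ n))"
    by (rule sum_Pow_Un[where F = "\<lambda>A B. h A * ((1 + \<kappa> * ((-1) ^ card A * (-1) ^ card B)) / 2 ^ n)"]) (use IJ in auto)
  also have "\<dots> = (\<Sum>A\<in>Pow I. h A * (2 ^ card J + \<kappa> * (-1) ^ card A * (\<Sum>B\<in>Pow J. (-1) ^ card B)) / 2 ^ n)"
    using IJ by (simp add: sum_distrib_left[symmetric] sum_divide_distrib[symmetric] sum.distrib
        mult.assoc card_Pow)
  also have "\<dots> = (\<Sum>A\<in>Pow I. h A * (1 + (if I = {..<n} then \<kappa> else 0) * (-1) ^ card A)) / 2 ^ card I"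
  proof (cases "J = {}")
    case True
    then have "I = {..<n}" using IJ by simp
    with True show ?thesis by (simp add: sum_divide_distrib)
  next
    case False
    then have "I \<noteq> {..<n}" by (auto simp: J_def)
    moreover have "(2::real) ^ n = 2 ^ card I * 2 ^ card J" by (simp flip: cIJ power_add)
    ultimately show ?thesis using False IJ by (simp add: sum_Pow_sign sum_divide_distrib)
  qed
  finally show ?thesis .
qed

lemma expectation_parity_sign:
  assumes "I \<subseteq> {..<n}" "I \<noteq> {}"
  shows "measure_pmf.expectation (parity_pmf n \<kappa>) (\<lambda>A. (-1) ^ card (A \<inter> I)) =
    (if I = {..<n} then \<kappa> else 0)"
proof -
  have fin: "finite I" using assms(1) by (rule finite_subset) simp
  have "measure_pmf.expectation (parity_pmf n \<kappa>) (\<lambda>A. (-1) ^ card (A \<inter> I)) =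
      (\<Sum>A\<in>Pow I. (-1) ^ card A + (if I = {..<n} then \<kappa> else 0)) / 2 ^ card I"
    using expectation_parity[OF assms(1), of "\<lambda>A. (-1) ^ card A"]
    by (simp add: algebra_simps flip: power_mult_distrib)
  then show ?thesis using fin assms(2) by (simp add: sum.distrib sum_Pow_sign card_Pow)
qed

text \<open>A single coin is a proper part of the cluster because \<open>2 \<le> n\<close>.\<close>

lemma prob_parity_mem:
  assumes "i < n" "2 \<le> n"
  shows "measure_pmf.prob (parity_pmf n \<kappa>) {A. i \<in> A \<longleftrightarrow> v} = 1 / 2"
proof -
  have ne: "{i} \<noteq> {..<n}" using assms(2) by (metis card.empty card_insert_disjoint card_lessThan
        empty_iff finite.emptyI not_less_eq_eq numeral_2_eq_2 One_nat_def le_refl)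
  have "measure_pmf.prob (parity_pmf n \<kappa>) {A. i \<in> A \<longleftrightarrow> v}
      = measure_pmf.expectation (parity_pmf n \<kappa>) (\<lambda>A. indicator {A. i \<in> A \<longleftrightarrow> v} (A \<inter> {i}))"
  proof -
    have "(\<lambda>A. indicator {A. i \<in> A \<longleftrightarrow> v} (A \<inter> {i})) = (indicator {A. i \<in> A \<longleftrightarrow> v} :: _ \<Rightarrow> real)"
      by (auto simp: indicator_def fun_eq_iff)
    then show ?thesis by simp
  qed
  also have "\<dots> = (\<Sum>A\<in>Pow {i}. indicator {A. i \<in> A \<longleftrightarrow> v} A) / 2"
    using assms ne by (subst expectation_parity) auto
  also have "Pow {i} = {{}, {i}}" by auto
  also have "(\<Sum>A\<in>{{}, {i}}. indicator {A. i \<in> A \<longleftrightarrow> v} A) = (1 :: real)"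
    by (cases v) simp_all
  finally show ?thesis .
qed

text \<open>The sign of a disjoint union is the product of the signs, so the joint law on
  \<open>I\<close> and \<open>J\<close> is the uniform product law plus a rank-one term.\<close>

lemma expectation_parity_split:
  assumes "I \<inter> J = {}" "I \<union> J \<subseteq> {..<n}"
  shows "measure_pmf.expectation (parity_pmf n \<kappa>) (\<lambda>A. f (A \<inter> I) * g (A \<inter> J)) =
    ((\<Sum>A\<in>Pow I. f A) * (\<Sum>B\<in>Pow J. g B) + (if I \<union> J = {..<n} then \<kappa> else 0) *
      (\<Sum>A\<in>Pow I. f A * (-1) ^ card A) * (\<Sum>B\<in>Pow J. g B * (-1) ^ card B)) / 2 ^ (card I + card J)"
proof -
  have fin: "finite I" "finite J" using assms(2) by (auto simp: finite_subset)
  let ?k = "if I \<union> J = {..<n} then \<kappa> else 0"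
  have "measure_pmf.expectation (parity_pmf n \<kappa>) (\<lambda>A. f (A \<inter> I) * g (A \<inter> J)) =
      measure_pmf.expectation (parity_pmf n \<kappa>) (\<lambda>A. f (A \<inter> (I \<union> J) \<inter> I) * g (A \<inter> (I \<union> J) \<inter> J))"
    by (simp add: Int_assoc Int_absorb1)
  also have "\<dots> = (\<Sum>A\<in>Pow (I \<union> J). f (A \<inter> I) * g (A \<inter> J) * (1 + ?k * (-1) ^ card A)) / 2 ^ card (I \<union> J)"
    using expectation_parity[OF assms(2), of "\<lambda>A. f (A \<inter> I) * g (A \<inter> J)"] by (simp add: Int_assoc)
  also have "(\<Sum>A\<in>Pow (I \<union> J). f (A \<inter> I) * g (A \<inter> J) * (1 + ?k * (-1) ^ card A)) =
      (\<Sum>A\<in>Pow (I \<union> J). f (A \<inter> I) * g (A \<inter> J) * (1 + ?k * ((-1) ^ card (A \<inter> I) * (-1) ^ card (A \<inter> J))))"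
  proof (rule sum.cong)
    fix A assume "A \<in> Pow (I \<union> J)"
    then have A: "A \<subseteq> I \<union> J" "finite A" using fin by (auto intro: finite_subset)
    have "card A = card (A \<inter> I) + card (A \<inter> J)"
      using assms A by (subst card_Un_disjoint[symmetric]) (auto intro!: arg_cong[of _ _ card])
    then show "f (A \<inter> I) * g (A \<inter> J) * (1 + ?k * (-1) ^ card A) =
        f (A \<inter> I) * g (A \<inter> J) * (1 + ?k * ((-1) ^ card (A \<inter> I) * (-1) ^ card (A \<inter> J)))"
      by (simp add: power_add)
  qed simp
  also have "\<dots> = (\<Sum>A\<in>Pow I. \<Sum>B\<in>Pow J. f A * g B * (1 + ?k * ((-1) ^ card A * (-1) ^ card B)))"
    by (rule sum_Pow_Un[where F = "\<lambda>A B. f A * g B * (1 + ?k * ((-1) ^ card A * (-1) ^ card B))"])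
      (use fin assms in auto)
  also have "\<dots> = (\<Sum>A\<in>Pow I. f A) * (\<Sum>B\<in>Pow J. g B) +
      ?k * (\<Sum>A\<in>Pow I. f A * (-1) ^ card A) * (\<Sum>B\<in>Pow J. g B * (-1) ^ card B)"
  proof -
    have "f A * g B * (1 + ?k * ((-1) ^ card A * (-1) ^ card B)) =
        f A * g B + ?k * ((f A * (-1) ^ card A) * (g B * (-1) ^ card B))" for A B
      by (simp add: algebra_simps)
    then have "(\<Sum>A\<in>Pow I. \<Sum>B\<in>Pow J. f A * g B * (1 + ?k * ((-1) ^ card A * (-1) ^ card B))) =
        (\<Sum>A\<in>Pow I. \<Sum>B\<in>Pow J. f A * g B) +
        ?k * (\<Sum>A\<in>Pow I. \<Sum>B\<in>Pow J. (f A * (-1) ^ card A) * (g B * (-1) ^ card B))"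
      by (simp only: sum.distrib sum_distrib_left)
    also have "\<dots> = (\<Sum>A\<in>Pow I. f A) * (\<Sum>B\<in>Pow J. g B) +
        ?k * ((\<Sum>A\<in>Pow I. f A * (-1) ^ card A) * (\<Sum>B\<in>Pow J. g B * (-1) ^ card B))"
      by (simp only: sum_product)
    finally show ?thesis by (simp only: mult.assoc)
  qed
  finally show ?thesis using fin assms by (simp add: card_Un_disjoint)
qed

text \<open>After centring, the uniform part of the joint law contributes nothing and the rank-one
  part gives \<kappa> times one sign coefficient of each function. Both proper parts are marginally
  uniform, so by Cauchy-Schwarz such a coefficient is at most the standard deviation in absolute
  value.\<close>

lemma views_bound_parity:
  assumes IJ: "I \<inter> J = {}" "I \<union> J \<subseteq> {..<n}" and r: "0 \<le> r"
    and split: "I \<union> J = {..<n} \<Longrightarrow> I \<noteq> {} \<Longrightarrow> J \<noteq> {} \<Longrightarrow> \<kappa> \<le> r"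
  shows "views_bound (parity_pmf n \<kappa>) (\<lambda>A. A \<inter> I) (\<lambda>A. A \<inter> J) r"
  unfolding views_bound_def
proof (intro allI)
  fix f g :: "nat set \<Rightarrow> real"
  let ?p = "parity_pmf n \<kappa>"
  let ?E = "measure_pmf.expectation ?p"
  let ?f = "f \<circ> (\<lambda>A. A \<inter> I)" and ?g = "g \<circ> (\<lambda>A. A \<inter> J)"
  let ?R = "r * sqrt (covar ?p ?f ?f * covar ?p ?g ?g)"
  have R: "0 \<le> ?R" by (intro mult_nonneg_nonneg r real_sqrt_ge_zero covar_self_nonneg)
  show "\<bar>covar ?p ?f ?g\<bar> \<le> ?R"
  proof (cases "I = {} \<or> J = {}")
    case True
    \<comment> \<open>A function of no coins is constant.\<close>
    then have "covar ?p ?f ?g = 0" by (auto simp: covar_def comp_def)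
    then show ?thesis using R by simp
  next
    case False
    have fin: "finite I" "finite J" using IJ(2) by (auto simp: finite_subset)
    have ne: "I \<noteq> {..<n}" "J \<noteq> {..<n}" using False IJ by auto
    define f0 g0 where "f0 A = f A - ?E ?f" and "g0 A = g A - ?E ?g" for A
    have E: "?E (\<lambda>A. h (A \<inter> I)) = (\<Sum>A\<in>Pow I. h A) / 2 ^ card I"
      "?E (\<lambda>A. h (A \<inter> J)) = (\<Sum>A\<in>Pow J. h A) / 2 ^ card J" for h :: "nat set \<Rightarrow> real"
      using expectation_parity[of I h] expectation_parity[of J h] IJ ne by simp_all
    have int: "integrable ?p h" for h :: "nat set \<Rightarrow> real"
      by (intro integrable_measure_pmf_finite finite_set_pmf_parity)
    have "?E (\<lambda>A. f0 (A \<inter> I)) = 0" "?E (\<lambda>A. g0 (A \<inter> J)) = 0"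
      unfolding f0_def g0_def by (simp_all add: int comp_def)
    then have z: "(\<Sum>A\<in>Pow I. f0 A) = 0" "(\<Sum>A\<in>Pow J. g0 A) = 0" by (simp_all add: E)
    define a b where "a = (\<Sum>A\<in>Pow I. f0 A * (-1) ^ card A) / 2 ^ card I"
      and "b = (\<Sum>A\<in>Pow J. g0 A * (-1) ^ card A) / 2 ^ card J"
    have cov: "covar ?p ?f ?g = (if I \<union> J = {..<n} then \<kappa> else 0) * a * b"
      using expectation_parity_split[OF IJ, of f0 g0] z
      by (simp add: covar_def f0_def g0_def a_def b_def power_add comp_def)
    have avg: "((\<Sum>A\<in>Pow S. h A * (-1) ^ card A) / 2 ^ card S)\<^sup>2 \<le> (\<Sum>A\<in>Pow S. (h A)\<^sup>2) / 2 ^ card S"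
      if "finite S" for S :: "nat set" and h :: "nat set \<Rightarrow> real"
    proof -
      have "(\<Sum>A\<in>Pow S. h A * (-1) ^ card A)\<^sup>2 \<le> (\<Sum>A\<in>Pow S. (h A)\<^sup>2) * (\<Sum>A\<in>Pow S. ((-1) ^ card A)\<^sup>2)"
        by (rule Cauchy_Schwarz_ineq_sum)
      also have "(\<Sum>A\<in>Pow S. ((-1 :: real) ^ card A)\<^sup>2) = 2 ^ card S"
        using that by (simp add: card_Pow flip: power_mult)
      finally show ?thesis by (simp add: power_divide divide_le_eq power2_eq_square)
    qed
    have va: "a\<^sup>2 \<le> covar ?p ?f ?f"
      using avg[OF fin(1), of f0] E(1)[of "\<lambda>A. (f0 A)\<^sup>2"]
      by (simp add: a_def covar_def f0_def power2_eq_square comp_def)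
    have vb: "b\<^sup>2 \<le> covar ?p ?g ?g"
      using avg[OF fin(2), of g0] E(2)[of "\<lambda>A. (g0 A)\<^sup>2"]
      by (simp add: b_def covar_def g0_def power2_eq_square comp_def)
    have "\<bar>a\<bar> * \<bar>b\<bar> = sqrt (a\<^sup>2 * b\<^sup>2)" by (simp add: real_sqrt_mult)
    also have "\<dots> \<le> sqrt (covar ?p ?f ?f * covar ?p ?g ?g)"
      using va vb by (intro real_sqrt_le_mono mult_mono) (auto simp: covar_self_nonneg)
    finally have ab: "\<bar>a\<bar> * \<bar>b\<bar> \<le> sqrt (covar ?p ?f ?f * covar ?p ?g ?g)" .
    show ?thesis
    proof (cases "I \<union> J = {..<n}")
      case True
      then have "\<bar>covar ?p ?f ?g\<bar> = \<kappa> * (\<bar>a\<bar> * \<bar>b\<bar>)"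
        using \<kappa> by (simp add: cov abs_mult)
      also have "\<dots> \<le> ?R"
        using ab split[OF True] False \<kappa> by (intro mult_mono) (auto simp: covar_self_nonneg)
      finally show ?thesis .
    qed (use R cov in simp)
  qed
qed

end

section \<open>Binary expansions\<close>

definition binary_real :: "(nat \<Rightarrow> bool) \<Rightarrow> real" where
  "binary_real a = (\<Sum>j. of_bool (a j) * (1/2) ^ Suc j)"

primrec binary_prefix :: "(nat \<Rightarrow> bool) \<Rightarrow> nat \<Rightarrow> nat" where
  "binary_prefix a 0 = 0"
| "binary_prefix a (Suc n) = 2 * binary_prefix a n + of_bool (a n)"

definition binary_digit :: "nat \<Rightarrow> real \<Rightarrow> bool" where
  "binary_digit j x = odd \<lfloor>x * 2 ^ Suc j\<rfloor>"

lemma summable_binary: "summable (\<lambda>j. of_bool (a j) * (1/2 :: real) ^ Suc j)"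
proof (rule summable_comparison_test')
  show "summable (\<lambda>j. (1/2 :: real) ^ Suc j)"
    using summable_geometric[of "1/2 :: real"] by (simp add: summable_Suc_iff)
qed simp

lemma sum_binary_prefix:
  "(\<Sum>j<n. of_bool (a j) * (1/2 :: real) ^ Suc j) = real (binary_prefix a n) / 2 ^ n"
  by (induction n) (auto simp: field_simps)

lemma binary_prefix_Suc_le:
  "n \<le> m \<Longrightarrow> real (binary_prefix a m) / 2 ^ m + 1 / 2 ^ m \<le> real (binary_prefix a n) / 2 ^ n + 1 / 2 ^ n"
proof (induction m rule: dec_induct)
  case (step m)
  have "real (binary_prefix a (Suc m)) / 2 ^ Suc m + 1 / 2 ^ Suc m
      \<le> real (binary_prefix a m) / 2 ^ m + 1 / 2 ^ m"
    by (simp add: field_simps)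
  then show ?case using step.IH by linarith
qed simp

lemma binary_real_ge: "real (binary_prefix a n) / 2 ^ n \<le> binary_real a"
  unfolding binary_real_def sum_binary_prefix[symmetric]
  by (rule sum_le_suminf[OF summable_binary]) auto

lemma binary_real_le: "binary_real a \<le> (real (binary_prefix a n) + 1) / 2 ^ n"
proof -
  have "(\<lambda>m. \<Sum>j<m. of_bool (a j) * (1/2 :: real) ^ Suc j) \<longlonglongrightarrow> binary_real a"
    unfolding binary_real_def by (rule summable_LIMSEQ[OF summable_binary])
  moreover have "(\<Sum>j<m. of_bool (a j) * (1/2 :: real) ^ Suc j) \<le> (real (binary_prefix a n) + 1) / 2 ^ n"
    if "n \<le> m" for m
  proof -
    have "real (binary_prefix a m) / 2 ^ m \<le> real (binary_prefix a m) / 2 ^ m + 1 / 2 ^ m" by simp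
    also have "\<dots> \<le> (real (binary_prefix a n) + 1) / 2 ^ n"
      using binary_prefix_Suc_le[OF that, of a] by (simp add: add_divide_distrib)
    finally show ?thesis unfolding sum_binary_prefix .
  qed
  ultimately show ?thesis by (intro LIMSEQ_le_const2) auto
qed

text \<open>The scaled value lies between the prefix and its successor; not being an integer, it has
  the prefix as its floor, whose last bit is \<open>a j\<close>.\<close>

lemma binary_digit_binary_real:
  assumes "binary_real a * 2 ^ Suc j \<notin> \<int>"
  shows "binary_digit j (binary_real a) \<longleftrightarrow> a j"
proof -
  let ?p = "binary_prefix a (Suc j)" and ?y = "binary_real a * 2 ^ Suc j"
  have "real ?p \<le> ?y" "?y \<le> real ?p + 1"
    using binary_real_ge[of a "Suc j"] binary_real_le[of a "Suc j"]
    by (simp_all add: field_simps del: binary_prefix.simps)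
  moreover have "?y \<noteq> real ?p + 1"
    using assms by (metis Ints_of_nat of_nat_Suc add.commute)
  ultimately have "\<lfloor>?y\<rfloor> = int ?p" by (intro floor_unique) auto
  then show ?thesis by (simp add: binary_digit_def)
qed

text \<open>Injectivity of the prefix in the form used by the union bound: the event of one prefix
  value lies inside one event of prescribed bits.\<close>

lemma binary_prefix_determines_bits:
  "\<exists>v. \<forall>a. binary_prefix a n = k \<longrightarrow> (\<forall>j<n. a j = v j)"
proof (induction n arbitrary: k)
  case (Suc n)
  from Suc.IH[of "k div 2"] obtain v
    where v: "\<And>a. binary_prefix a n = k div 2 \<Longrightarrow> (\<forall>j<n. a j = v j)" by blast
  have "\<forall>j<Suc n. a j = (v(n := odd k)) j" if "binary_prefix a (Suc n) = k" for a
  proof -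
    have "binary_prefix a n = k div 2" "a n = odd k" using that by auto
    with v[of a] show ?thesis by (auto simp: less_Suc_eq)
  qed
  then show ?case by blast
qed simp

lemma binary_prefix_less: "binary_prefix a n < 2 ^ n"
  by (induction n) auto

lemma borel_measurable_binary_real:
  assumes "\<And>j. Measurable.pred M (\<lambda>\<omega>. a \<omega> j)"
  shows "(\<lambda>\<omega>. binary_real (a \<omega>)) \<in> borel_measurable M"
  unfolding binary_real_def of_bool_def using assms by measurable


section \<open>Random binary expansions: uniformity and recovery of digits\<close>

context prob_space
begin

text \<open>A union bound over the prefix values. An upper bound suffices for the distribution
  function, since it is applied to an event and to its complement.\<close>

lemma prob_binary_prefix_le:
  assumes a: "\<And>j. Measurable.pred M (\<lambda>\<omega>. a \<omega> j)"
    and fair: "\<And>n v. prob {\<omega>\<in>space M. \<forall>j<n. a \<omega> j = v j} = (1/2) ^ n"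
    and K: "finite K"
  shows "prob {\<omega>\<in>space M. binary_prefix (a \<omega>) n \<in> K} \<le> card K / 2 ^ n"
proof -
  have pred: "Measurable.pred M (\<lambda>\<omega>. \<forall>j<n. a \<omega> j = v j)" for v
    using a by measurable
  have "\<exists>v. {\<omega>\<in>space M. binary_prefix (a \<omega>) n = k} \<subseteq> {\<omega>\<in>space M. \<forall>j<n. a \<omega> j = v j}" for k
    using binary_prefix_determines_bits[of n k] by blast
  then have "\<exists>v. \<forall>k. {\<omega>\<in>space M. binary_prefix (a \<omega>) n = k} \<subseteq> {\<omega>\<in>space M. \<forall>j<n. a \<omega> j = v k j}"
    by (intro choice allI)
  then obtain v where v: "\<And>k. {\<omega>\<in>space M. binary_prefix (a \<omega>) n = k} \<subseteq> {\<omega>\<in>space M. \<forall>j<n. a \<omega> j = v k j}"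
    by (elim exE) (rule that, erule spec)
  have "prob {\<omega>\<in>space M. binary_prefix (a \<omega>) n \<in> K} \<le> prob (\<Union>k\<in>K. {\<omega>\<in>space M. \<forall>j<n. a \<omega> j = v k j})"
  proof (rule finite_measure_mono)
    show "(\<Union>k\<in>K. {\<omega>\<in>space M. \<forall>j<n. a \<omega> j = v k j}) \<in> events"
      by (rule sets.finite_UN[OF K]) (rule pred[unfolded pred_def])
    show "{\<omega>\<in>space M. binary_prefix (a \<omega>) n \<in> K} \<subseteq> (\<Union>k\<in>K. {\<omega>\<in>space M. \<forall>j<n. a \<omega> j = v k j})"
    proof
      fix \<omega> assume "\<omega> \<in> {\<omega>\<in>space M. binary_prefix (a \<omega>) n \<in> K}"
      then show "\<omega> \<in> (\<Union>k\<in>K. {\<omega>\<in>space M. \<forall>j<n. a \<omega> j = v k j})"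
        using v[of "binary_prefix (a \<omega>) n"] by (intro UN_I[of "binary_prefix (a \<omega>) n"]) auto
    qed
  qed
  also have "\<dots> \<le> (\<Sum>k\<in>K. prob {\<omega>\<in>space M. \<forall>j<n. a \<omega> j = v k j})"
    by (rule finite_measure_subadditive_finite[OF K]) (rule image_subsetI, rule pred[unfolded pred_def])
  also have "\<dots> = card K / 2 ^ n" unfolding fair by (simp add: power_one_over)
  finally show ?thesis .
qed

text \<open>The distribution functions are compared at dyadic precision \<open>(1/2) ^ n\<close> for
  every \<open>n\<close>.\<close>

lemma distr_binary_real_uniform:
  assumes a: "\<And>j. Measurable.pred M (\<lambda>\<omega>. a \<omega> j)"
    and fair: "\<And>n v. prob {\<omega>\<in>space M. \<forall>j<n. a \<omega> j = v j} = (1/2) ^ n"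
  shows "distr M borel (\<lambda>\<omega>. binary_real (a \<omega>)) = uniform_measure lborel {0..1}"
proof (rule cdf_unique)
  let ?X = "\<lambda>\<omega>. binary_real (a \<omega>)"
  have X: "?X \<in> borel_measurable M" by (rule borel_measurable_binary_real[OF a])
  interpret U: prob_space "uniform_measure lborel {0..1::real}"
    by (rule prob_space_uniform_measure) auto
  interpret D: prob_space "distr M borel ?X" by (rule prob_space_distr[OF X])
  show "real_distribution (distr M borel ?X)" "real_distribution (uniform_measure lborel {0..1::real})"
    by unfold_locales auto
  have bounds: "0 \<le> ?X \<omega>" "?X \<omega> \<le> 1" for \<omega>
    using binary_real_ge[of "a \<omega>" 0] binary_real_le[of "a \<omega>" 0] by auto
  have cdfX: "cdf (distr M borel ?X) x = prob {\<omega>\<in>space M. ?X \<omega> \<le> x}" for x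
    unfolding cdf_def2 using X by (subst measure_distr) (auto intro!: arg_cong[of _ _ prob])
  have cdfU: "cdf (uniform_measure lborel {0..1}) x = measure lborel ({0..1} \<inter> {..x})" for x :: real
    unfolding cdf_def2 by (subst measure_uniform_measure) auto
  have meas: "{\<omega>\<in>space M. ?X \<omega> \<le> x} \<in> events" for x using X by measurable
  show "cdf (distr M borel ?X) = cdf (uniform_measure lborel {0..1})"
  proof
    fix x :: real
    consider "x < 0" | "1 < x" | "0 \<le> x" "x \<le> 1" by linarith
    then show "cdf (distr M borel ?X) x = cdf (uniform_measure lborel {0..1}) x"
    proof cases
      case 1
      then have "{\<omega>\<in>space M. ?X \<omega> \<le> x} = {}" by (auto dest: order.trans[OF bounds(1)])
      moreover have "{0..1} \<inter> {..x} = {}" using 1 by auto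
      ultimately show ?thesis unfolding cdfX cdfU by (simp only: measure_empty)
    next
      case 2
      then have "{\<omega>\<in>space M. ?X \<omega> \<le> x} = space M" by (auto intro: order.trans[OF bounds(2)])
      moreover have "{0..1} \<inter> {..x} = {0..1}" using 2 by auto
      ultimately show ?thesis by (simp add: cdfX cdfU prob_space)
    next
      case 3
      have pre: "{\<omega>\<in>space M. binary_prefix (a \<omega>) n \<in> K} \<in> events" for n K
      proof -
        have "Measurable.pred M (\<lambda>\<omega>. binary_prefix (a \<omega>) n \<in> K)" for K
        proof (induction n arbitrary: K)
          case (Suc n)
          have "(binary_prefix (a \<omega>) (Suc n) \<in> K) \<longleftrightarrow>
              (if a \<omega> n then binary_prefix (a \<omega>) n \<in> {k. 2 * k + 1 \<in> K} else binary_prefix (a \<omega>) n \<in> {k. 2 * k \<in> K})" for \<omega>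
            by simp
          then show ?case using Suc[of "{k. 2 * k + 1 \<in> K}"] Suc[of "{k. 2 * k \<in> K}"] a by simp
        qed simp
        then show ?thesis by (simp add: pred_def)
      qed
      have bound: "\<bar>prob {\<omega>\<in>space M. ?X \<omega> \<le> x} - x\<bar> \<le> (1/2) ^ n" for n
      proof -
        \<comment> \<open>Index of the dyadic interval containing \<open>x\<close>. The event
          \<open>?X \<omega> \<le> x\<close> forces a prefix of at most \<open>k\<close>, its
          complement one of at least \<open>k\<close>; the value \<open>k\<close> counted twice
          accounts for the error \<open>(1/2) ^ n\<close>.\<close>
        define k where "k = nat \<lfloor>x * 2 ^ n\<rfloor>"
        have "0 \<le> x * 2 ^ n" using 3 by simp
        then have "0 \<le> \<lfloor>x * 2 ^ n\<rfloor>" by (simp only: zero_le_floor)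
        then have "real k = of_int \<lfloor>x * 2 ^ n\<rfloor>" by (simp only: k_def of_nat_nat)
        then have k: "real k \<le> x * 2 ^ n" "x * 2 ^ n < real k + 1" by linarith+
        have k_le: "k \<le> 2 ^ n"
        proof -
          have "x * 2 ^ n \<le> 1 * 2 ^ n" using 3(2) by (rule mult_right_mono) simp
          then have "real k \<le> 2 ^ n" using k(1) by linarith
          then show ?thesis by simp
        qed
        have "prob {\<omega>\<in>space M. ?X \<omega> \<le> x} \<le> prob {\<omega>\<in>space M. binary_prefix (a \<omega>) n \<in> {..<Suc k}}"
        proof (intro finite_measure_mono pre subsetI CollectI conjI; elim CollectE conjE)
          fix \<omega> assume "?X \<omega> \<le> x"
          then have "real (binary_prefix (a \<omega>) n) / 2 ^ n \<le> x"
            using binary_real_ge[of "a \<omega>" n] by linarith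
          then have "real (binary_prefix (a \<omega>) n) \<le> x * 2 ^ n"
            by (simp only: pos_divide_le_eq zero_less_power zero_less_numeral)
          with k(2) have "binary_prefix (a \<omega>) n < Suc k" by linarith
          then show "binary_prefix (a \<omega>) n \<in> {..<Suc k}" by simp
        qed
        also have "\<dots> \<le> card {..<Suc k} / 2 ^ n"
          by (rule prob_binary_prefix_le[OF a fair]) auto
        also have "\<dots> = real k / 2 ^ n + (1/2) ^ n"
          by (simp add: add_divide_distrib power_one_over)
        also have "\<dots> \<le> x + (1/2) ^ n" using k(1) by (simp add: pos_divide_le_eq)
        finally have up: "prob {\<omega>\<in>space M. ?X \<omega> \<le> x} \<le> x + (1/2) ^ n" .
        have "1 - prob {\<omega>\<in>space M. ?X \<omega> \<le> x} = prob (space M - {\<omega>\<in>space M. ?X \<omega> \<le> x})"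
          by (rule prob_compl[OF meas, symmetric])
        also have "\<dots> \<le> prob {\<omega>\<in>space M. binary_prefix (a \<omega>) n \<in> {k..<2 ^ n}}"
        proof (intro finite_measure_mono pre subsetI CollectI conjI; elim DiffE)
          fix \<omega> assume "\<omega> \<in> space M" "\<omega> \<notin> {\<omega>\<in>space M. ?X \<omega> \<le> x}"
          then have "x < (real (binary_prefix (a \<omega>) n) + 1) / 2 ^ n"
            using binary_real_le[of "a \<omega>" n] by auto
          then have "x * 2 ^ n < real (binary_prefix (a \<omega>) n) + 1"
            by (simp only: pos_less_divide_eq zero_less_power zero_less_numeral)
          with k(1) have "k \<le> binary_prefix (a \<omega>) n" by linarith
          with binary_prefix_less[of "a \<omega>" n] show "binary_prefix (a \<omega>) n \<in> {k..<2 ^ n}" by simp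
        qed
        also have "\<dots> \<le> card {k..<2 ^ n} / 2 ^ n"
          by (rule prob_binary_prefix_le[OF a fair]) auto
        also have "\<dots> = 1 + (1/2) ^ n - (real k + 1) / 2 ^ n"
          using k_le by (simp add: of_nat_diff diff_divide_distrib add_divide_distrib power_one_over)
        also have "\<dots> \<le> 1 + (1/2) ^ n - x" using k(2) by (simp add: pos_le_divide_eq)
        finally show ?thesis using up by linarith
      qed
      have "\<bar>prob {\<omega>\<in>space M. ?X \<omega> \<le> x} - x\<bar> \<le> 0"
      proof (rule LIMSEQ_le_const)
        show "(\<lambda>n. (1/2 :: real) ^ n) \<longlonglongrightarrow> 0" by (rule LIMSEQ_power_zero) simp
      qed (use bound in auto)
      moreover have "{0..1} \<inter> {..x} = {0..x}" using 3 by auto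
      ultimately show ?thesis using 3 by (simp add: cdfX cdfU)
    qed
  qed
qed

text \<open>Digits are ambiguous only at countably many dyadic rationals, which the uniform law does
  not charge.\<close>

lemma AE_binary_digit:
  assumes a: "\<And>j. Measurable.pred M (\<lambda>\<omega>. a \<omega> j)"
    and fair: "\<And>n v. prob {\<omega>\<in>space M. \<forall>j<n. a \<omega> j = v j} = (1/2) ^ n"
  shows "AE \<omega> in M. binary_digit j (binary_real (a \<omega>)) \<longleftrightarrow> a \<omega> j"
proof -
  let ?X = "\<lambda>\<omega>. binary_real (a \<omega>)" and ?D = "{x :: real. x * 2 ^ Suc j \<in> \<int>}"
  have X: "?X \<in> borel_measurable M" by (rule borel_measurable_binary_real[OF a])
  have "?D \<subseteq> (\<lambda>k. real_of_int k / 2 ^ Suc j) ` UNIV"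
    by (auto elim!: Ints_cases simp: field_simps image_iff)
  then have "countable ?D" by (rule countable_subset) simp
  then have D: "?D \<in> null_sets lborel" by (rule countable_imp_null_set_lborel)
  then have "AE x in uniform_measure lborel {0..1}. x \<notin> ?D"
    by (intro AE_uniform_measureI) (auto intro: AE_mp[OF AE_not_in])
  then have "AE x in distr M borel ?X. x \<notin> ?D"
    unfolding distr_binary_real_uniform[OF a fair] .
  moreover have "- ?D \<in> sets borel" using D by (intro borel_comp) auto
  then have "{x \<in> space borel. x \<notin> ?D} \<in> sets borel" by (simp add: Compl_eq)
  ultimately have "AE \<omega> in M. ?X \<omega> \<notin> ?D"
    by (simp only: AE_distr_iff[OF X])
  then show ?thesis by (rule AE_mp) (auto intro!: AE_I2 binary_digit_binary_real)
qed

end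

section \<open>Superposition of parity-biased clusters\<close>

text \<open>The type \<open>'b\<close> indexes cluster shapes. Countability allows the bits at a
  site to be enumerated, and infinitude supplies the endless expansion that a uniform variable
  requires.\<close>

locale parity_field =
  fixes len :: "'b::countable \<Rightarrow> nat" and \<kappa> :: "'b \<Rightarrow> real" and Q :: "'b \<Rightarrow> nat \<Rightarrow> 'v::ab_group_add"
  assumes len: "2 \<le> len b" and bias: "0 \<le> \<kappa> b" "\<kappa> b \<le> 1"
    and inj: "inj_on (Q b) {..<len b}" and inf: "infinite (UNIV :: 'b set)"
begin

text \<open>The cluster \<open>(b, m)\<close> is a random set of indices; membership of \<open>i\<close> is one of the bits that make up
  the field at the site \<open>m + Q b i\<close>.\<close>

definition cluster :: "'b \<times> 'v \<Rightarrow> nat set pmf" where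
  "cluster c = parity_pmf (len (fst c)) (\<kappa> (fst c))"

definition \<P> :: "('b \<times> 'v \<Rightarrow> nat set) measure" where
  "\<P> = (\<Pi>\<^sub>M c\<in>UNIV. measure_pmf (cluster c))"

definition idx :: "'v set \<Rightarrow> 'b \<times> 'v \<Rightarrow> nat set" where
  "idx S c = {i. i < len (fst c) \<and> snd c + Q (fst c) i \<in> S}"

text \<open>The value \<open>{}\<close> outside \<open>F\<close> agrees with the default of
  \<open>Pi_pmf F {} cluster\<close>, so views of the infinite family and of a finite subfamily lie
  in the same finite set.\<close>

definition view :: "('b \<times> 'v) set \<Rightarrow> 'v set \<Rightarrow> ('b \<times> 'v \<Rightarrow> nat set) \<Rightarrow> 'b \<times> 'v \<Rightarrow> nat set" where
  "view F S \<omega> = (\<lambda>c. if c \<in> F then \<omega> c \<inter> idx S c else {})"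

definition cylinder_functions :: "'v set \<Rightarrow> (('b \<times> 'v \<Rightarrow> nat set) \<Rightarrow> real) set" where
  "cylinder_functions S = {\<lambda>\<omega>. h (view F S \<omega>) | h F. finite F}"

text \<open>Defined through indicators so that the density lemma applies at once and intersections
  become products of functions.\<close>

definition cylinder_sets :: "'v set \<Rightarrow> ('b \<times> 'v \<Rightarrow> nat set) set set" where
  "cylinder_sets S = {E. indicator E \<in> cylinder_functions S}"

sublocale cluster: parity_cluster "len b" "\<kappa> b" for b
  using len[of b] bias[of b] by unfold_locales auto

sublocale product: product_prob_space "\<lambda>c. measure_pmf (cluster c)" UNIV
  by unfold_locales

sublocale P: prob_space \<P>
  unfolding \<P>_def by (rule prob_space_PiM) (rule measure_pmf.prob_space_axioms)

section \<open>Finite views of the product space\<close>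

lemma space_P [simp]: "space \<P> = UNIV"
  by (simp add: \<P>_def space_PiM PiE_def)

lemma idx_UNIV: "idx UNIV c = {..<len (fst c)}"
  by (auto simp: idx_def)

lemma idx_subset: "idx S c \<subseteq> {..<len (fst c)}"
  by (auto simp: idx_def)

lemma measurable_cluster_event: "{\<omega>. \<omega> c \<in> A} \<in> sets \<P>"
proof -
  have "(\<lambda>\<omega>. \<omega> c) \<in> measurable \<P> (measure_pmf (cluster c))"
    unfolding \<P>_def by (rule measurable_component_singleton) simp
  from measurable_sets[OF this, of A] show ?thesis by (simp add: vimage_def)
qed

lemma measurable_cylinder:
  assumes "finite F" shows "{\<omega>. \<forall>c\<in>F. \<omega> c \<in> A c} \<in> sets \<P>"
proof -
  have "{\<omega>. \<forall>c\<in>F. \<omega> c \<in> A c} = space \<P> - (\<Union>c\<in>F. {\<omega>. \<omega> c \<in> - A c})" by auto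
  also have "\<dots> \<in> sets \<P>"
    using assms by (intro sets.Diff sets.top sets.finite_UN measurable_cluster_event)
  finally show ?thesis .
qed

lemma prob_cylinder:
  assumes "finite F"
  shows "P.prob {\<omega>. \<forall>c\<in>F. \<omega> c \<in> A c} = (\<Prod>c\<in>F. measure_pmf.prob (cluster c) (A c))"
proof -
  have "{\<omega>. \<forall>c\<in>F. \<omega> c \<in> A c} = prod_emb UNIV (\<lambda>c. measure_pmf (cluster c)) F (Pi\<^sub>E F A)"
    by (auto simp: prod_emb_def PiE_iff)
  then show ?thesis
    unfolding \<P>_def using assms by (simp add: product.measure_PiM_emb)
qed

definition views :: "('b \<times> 'v) set \<Rightarrow> ('b \<times> 'v \<Rightarrow> nat set) set" where
  "views F = PiE_dflt F {} (\<lambda>c. Pow {..<len (fst c)})"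

lemma finite_views: "finite F \<Longrightarrow> finite (views F)"
  unfolding views_def by (intro finite_PiE_dflt) auto

lemma view_in_views: "view F S \<omega> \<in> views F"
  by (auto simp: views_def view_def PiE_dflt_def idx_def)

lemma view_views: "v \<in> views F \<Longrightarrow> view F UNIV v = v"
  by (auto simp: views_def view_def PiE_dflt_def idx_UNIV fun_eq_iff)

lemma view_view_UNIV: "view F S (view F UNIV \<omega>) = view F S \<omega>"
  by (auto simp: view_def idx_def fun_eq_iff)

lemma view_view_mono: "F \<subseteq> F' \<Longrightarrow> view F S (view F' S \<omega>) = view F S \<omega>"
  by (auto simp: view_def fun_eq_iff)

lemma view_eq_iff:
  assumes "v \<in> views F"
  shows "view F S \<omega> = v \<longleftrightarrow> (\<forall>c\<in>F. \<omega> c \<in> {A. A \<inter> idx S c = v c})"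
proof
  assume "\<forall>c\<in>F. \<omega> c \<in> {A. A \<inter> idx S c = v c}"
  then show "view F S \<omega> = v"
    using assms by (intro ext) (auto simp: views_def PiE_dflt_def view_def)
qed (auto simp: view_def)

text \<open>A view has finitely many values, so measurability and integration of its functions
  reduce to cylinder events.\<close>

lemma view_function_sum:
  assumes "finite F"
  shows "(h (view F S \<omega>) :: real) = (\<Sum>v\<in>views F. h v * indicator {\<omega>. view F S \<omega> = v} \<omega>)"
proof -
  have "(\<Sum>v\<in>views F. h v * indicator {\<omega>. view F S \<omega> = v} \<omega>) =
      (\<Sum>v\<in>views F. if v = view F S \<omega> then h v else 0)"
    by (rule sum.cong) (auto simp: indicator_def)
  then show ?thesis using finite_views[OF assms] view_in_views[of F S \<omega>] by simp
qed

lemma measurable_view: 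
  assumes "finite F"
  shows "{\<omega>. view F S \<omega> = v} \<in> sets \<P>"
proof (cases "v \<in> views F")
  case True
  show ?thesis unfolding view_eq_iff[OF True] by (rule measurable_cylinder[OF assms])
next
  case False
  then have "{\<omega>. view F S \<omega> = v} = {}" using view_in_views[of F S] by auto
  then show ?thesis by simp
qed

lemma borel_measurable_view_function:
  assumes "finite F"
  shows "(\<lambda>\<omega>. h (view F S \<omega>) :: real) \<in> borel_measurable \<P>"
  unfolding view_function_sum[OF assms, of h S]
  by (intro borel_measurable_sum borel_measurable_times borel_measurable_const
      borel_measurable_indicator measurable_view assms)

lemma L2_cylinder_function:
  assumes "f \<in> cylinder_functions S" shows "L2 \<P> f"
proof -
  obtain h F where f: "f = (\<lambda>\<omega>. h (view F S \<omega>))" and F: "finite F"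
    using assms unfolding cylinder_functions_def by blast
  have "\<bar>h (view F S \<omega>)\<bar> \<le> (\<Sum>v\<in>views F. \<bar>h v\<bar>)" for \<omega>
    using finite_views[OF F] view_in_views[of F S \<omega>] by (intro member_le_sum) auto
  then show ?thesis
    unfolding f using borel_measurable_view_function[OF F] by (intro P.L2_bounded)
qed

text \<open>The bridge from the infinite product measure to finite products of pmfs, where
  tensorization is available.\<close>

lemma expectation_view:
  assumes F: "finite F"
  shows "(LINT \<omega>|\<P>. h (view F UNIV \<omega>)) =
    measure_pmf.expectation (Pi_pmf F {} cluster) (\<lambda>x. h (view F UNIV x) :: real)"
proof -
  have "(LINT \<omega>|\<P>. h (view F UNIV \<omega>)) =
      (LINT \<omega>|\<P>. (\<Sum>v\<in>views F. h v * indicator {\<omega>. view F UNIV \<omega> = v} \<omega>))"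
    by (subst view_function_sum[OF F, of h UNIV]) simp
  also have "\<dots> = (\<Sum>v\<in>views F. h v * P.prob {\<omega>. view F UNIV \<omega> = v})"
    using measurable_view[OF F, of UNIV]
    by (subst Bochner_Integration.integral_sum)
      (auto intro!: integrable_real_indicator simp: P.emeasure_eq_measure)
  also have "\<dots> = (\<Sum>v\<in>views F. h (view F UNIV v) * pmf (Pi_pmf F {} cluster) v)"
  proof (rule sum.cong)
    fix v assume v: "v \<in> views F"
    have "measure_pmf.prob (cluster c) {A. A \<inter> idx UNIV c = v c} = pmf (cluster c) (v c)"
      if "c \<in> F" for c
    proof -
      have "v c \<subseteq> {..<len (fst c)}" using v that unfolding views_def PiE_dflt_def by blast
      \<comment> \<open>Intersecting with \<open>idx UNIV c\<close> changes nothing on the support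
        of the cluster.\<close>
      then have "{A. A \<inter> idx UNIV c = v c} \<inter> set_pmf (cluster c) = {v c} \<inter> set_pmf (cluster c)"
        using cluster.set_pmf_parity[of "fst c"] by (auto simp: idx_UNIV cluster_def)
      then show ?thesis
        by (metis measure_Int_set_pmf measure_pmf_single)
    qed
    then have "P.prob {\<omega>. view F UNIV \<omega> = v} = pmf (Pi_pmf F {} cluster) v"
      unfolding view_eq_iff[OF v] using v F
      by (subst prob_cylinder[OF F], subst pmf_Pi'[OF F])
        (auto simp: views_def PiE_dflt_def intro!: prod.cong)
    then show "h v * P.prob {\<omega>. view F UNIV \<omega> = v} =
        h (view F UNIV v) * pmf (Pi_pmf F {} cluster) v"
      by (simp add: view_views[OF v])
  qed simp
  also have "\<dots> = measure_pmf.expectation (Pi_pmf F {} cluster) (\<lambda>x. h (view F UNIV x))"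
  proof (rule integral_measure_pmf_real[symmetric, OF finite_views[OF F]])
    fix v assume "v \<in> set_pmf (Pi_pmf F {} cluster)"
    then have v: "v \<in> PiE_dflt F {} (\<lambda>c. set_pmf (cluster c))"
      using set_Pi_pmf_subset'[OF F, of "{}" cluster] by (auto simp: comp_def)
    have "set_pmf (cluster c) \<subseteq> Pow {..<len (fst c)}" for c
      unfolding cluster_def by (rule cluster.set_pmf_parity)
    with v show "v \<in> views F" unfolding views_def PiE_dflt_def by blast
  qed
  finally show ?thesis .
qed

text \<open>Over a common finite set of clusters the two views act cluster by cluster, so
  tensorization reduces the bound to single clusters; only those covered and split by
  \<open>S\<close> and \<open>T\<close> carry any dependence.\<close>

lemma covar_bound_cylinder:
  assumes disj: "S \<inter> T = {}" and r: "0 \<le> r"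
    and split: "\<And>c. idx S c \<union> idx T c = {..<len (fst c)} \<Longrightarrow> idx S c \<noteq> {} \<Longrightarrow> idx T c \<noteq> {} \<Longrightarrow>
      \<kappa> (fst c) \<le> r"
    and f: "f \<in> cylinder_functions S" and g: "g \<in> cylinder_functions T"
  shows "\<bar>covar \<P> f g\<bar> \<le> r * sqrt (covar \<P> f f * covar \<P> g g)"
proof -
  obtain h F1 where f_eq: "f = (\<lambda>\<omega>. h (view F1 S \<omega>))" and F1: "finite F1"
    using f unfolding cylinder_functions_def by blast
  obtain k F2 where g_eq: "g = (\<lambda>\<omega>. k (view F2 T \<omega>))" and F2: "finite F2"
    using g unfolding cylinder_functions_def by blast
  define F where "F = F1 \<union> F2"
  have F: "finite F" "F1 \<subseteq> F" "F2 \<subseteq> F" using F1 F2 by (auto simp: F_def)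
  let ?q = "Pi_pmf F {} cluster"
  \<comment> \<open>Both functions are rewritten as functions of views of the same
    \<open>F\<close>.\<close>
  define f' where "f' = (\<lambda>v. h (view F1 S v)) \<circ> view F S"
  define g' where "g' = (\<lambda>v. k (view F2 T v)) \<circ> view F T"
  have f'g': "f' = f" "g' = g"
    using F by (auto simp: f'_def g'_def f_eq g_eq view_view_mono)
  have "covar \<P> (\<lambda>\<omega>. h (view F UNIV \<omega>)) (\<lambda>\<omega>. k (view F UNIV \<omega>)) =
      covar ?q (\<lambda>\<omega>. h (view F UNIV \<omega>)) (\<lambda>\<omega>. k (view F UNIV \<omega>))" for h k
    unfolding covar_def expectation_view[OF F(1), of h] expectation_view[OF F(1), of k]
    by (rule expectation_view[OF F(1)])
  then have eq: "covar \<P> (h \<circ> view F UNIV) (k \<circ> view F UNIV) =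
      covar ?q (h \<circ> view F UNIV) (k \<circ> view F UNIV)" for h k
    by (simp add: comp_def)
  have "f' = f' \<circ> view F UNIV" "g' = g' \<circ> view F UNIV"
    by (auto simp: f'_def g'_def view_view_UNIV)
  then have cov: "covar \<P> f' g' = covar ?q f' g'" "covar \<P> f' f' = covar ?q f' f'"
      "covar \<P> g' g' = covar ?q g' g'"
    using eq by metis+
  have "views_bound ?q (view F S) (view F T) r"
    unfolding view_def[abs_def]
  proof (rule views_bound_Pi_pmf[OF F(1) _ r])
    fix c assume "c \<in> F"
    show "finite (set_pmf (cluster c))"
      unfolding cluster_def by (rule cluster.finite_set_pmf_parity)
    show "views_bound (cluster c) (\<lambda>A. A \<inter> idx S c) (\<lambda>A. A \<inter> idx T c) r"
      unfolding cluster_def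
      by (rule cluster.views_bound_parity[OF _ _ r split])
        (use disj idx_subset in \<open>auto simp: idx_def\<close>)
  qed
  then show ?thesis
    unfolding views_bound_def f'g'[symmetric] cov by (auto simp: f'_def g'_def)
qed

text \<open>One closure property serves sums, scalar multiples and the products behind
  intersection-stability.\<close>

lemma cylinder_functions_binop:
  assumes "f \<in> cylinder_functions S" "g \<in> cylinder_functions S"
  shows "(\<lambda>\<omega>. op2 (f \<omega>) (g \<omega>)) \<in> cylinder_functions S"
proof -
  obtain h F1 where f_eq: "f = (\<lambda>\<omega>. h (view F1 S \<omega>))" and F1: "finite F1"
    using assms(1) unfolding cylinder_functions_def by blast
  obtain k F2 where g_eq: "g = (\<lambda>\<omega>. k (view F2 S \<omega>))" and F2: "finite F2"
    using assms(2) unfolding cylinder_functions_def by blast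
  have "(\<lambda>\<omega>. op2 (f \<omega>) (g \<omega>)) =
      (\<lambda>\<omega>. (\<lambda>v. op2 (h (view F1 S v)) (k (view F2 S v))) (view (F1 \<union> F2) S \<omega>))"
    by (simp add: f_eq g_eq view_view_mono)
  then show ?thesis
    unfolding cylinder_functions_def using F1 F2
    by (intro CollectI exI[of _ "\<lambda>v. op2 (h (view F1 S v)) (k (view F2 S v))"] exI[of _ "F1 \<union> F2"]) simp
qed

lemma cylinder_functions_const: "(\<lambda>\<omega>. x) \<in> cylinder_functions S"
  unfolding cylinder_functions_def by (auto intro!: exI[of _ "\<lambda>_. x"] exI[of _ "{}"])

section \<open>The covariance bound on generated sigma-fields\<close>

definition \<B> :: "'v set \<Rightarrow> ('b \<times> 'v \<Rightarrow> nat set) measure" where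
  "\<B> S = sigma (space \<P>) (cylinder_sets S)"

lemma cylinder_sets_measurable: "cylinder_sets S \<subseteq> sets \<P>"
proof
  fix E assume "E \<in> cylinder_sets S"
  then have "(indicator E :: _ \<Rightarrow> real) \<in> borel_measurable \<P>"
    using L2_cylinder_function[of "indicator E" S] by (simp add: cylinder_sets_def L2_def)
  then show "E \<in> sets \<P>" by (simp add: borel_measurable_indicator_iff)
qed

lemma Int_stable_cylinder_sets: "Int_stable (cylinder_sets S)"
proof (rule Int_stableI)
  fix a b assume "a \<in> cylinder_sets S" "b \<in> cylinder_sets S"
  then show "a \<inter> b \<in> cylinder_sets S"
    using cylinder_functions_binop[of "indicator a" S "indicator b" "(*)"]
    by (simp add: cylinder_sets_def indicator_inter_arith[abs_def])
qed

theorem covar_bound: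
  assumes disj: "S \<inter> T = {}" and r: "0 \<le> r"
    and split: "\<And>c. idx S c \<union> idx T c = {..<len (fst c)} \<Longrightarrow> idx S c \<noteq> {} \<Longrightarrow> idx T c \<noteq> {} \<Longrightarrow>
      \<kappa> (fst c) \<le> r"
    and f: "f \<in> borel_measurable (\<B> S)" "L2 \<P> f" and g: "g \<in> borel_measurable (\<B> T)" "L2 \<P> g"
  shows "\<bar>covar \<P> f g\<bar> \<le> r * sqrt (covar \<P> f f * covar \<P> g g)"
proof -
  have dense: "f \<in> L2_closure \<P> (cylinder_functions S)"
    if "f \<in> borel_measurable (\<B> S)" "L2 \<P> f" for f S
  proof (rule P.L2_closure_sigma[OF _ _ _ _ Int_stable_cylinder_sets[of S] cylinder_sets_measurable])
    show "f \<in> borel_measurable (sigma (space \<P>) (cylinder_sets S))" "L2 \<P> f"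
      using that by (simp_all add: \<B>_def)
    show "(\<lambda>x. h x + k x) \<in> cylinder_functions S"
      if "h \<in> cylinder_functions S" "k \<in> cylinder_functions S" for h k
      using cylinder_functions_binop[OF that] .
    show "(\<lambda>x. a * h x) \<in> cylinder_functions S" if "h \<in> cylinder_functions S" for h a
      using cylinder_functions_binop[OF that that, of "\<lambda>x _. a * x"] .
  qed (auto simp: L2_cylinder_function cylinder_functions_const cylinder_sets_def)
  show ?thesis
    by (rule P.covar_bound_L2_closure[OF L2_cylinder_function L2_cylinder_function
          covar_bound_cylinder[OF disj r split] f(2) dense[OF f] g(2) dense[OF g]])
qed

section \<open>The field of binary expansions\<close>

definition digits :: "('b \<times> nat) set" where
  "digits = {(b, i). i < len b}"

text \<open>The cluster of shape \<open>b\<close> whose point \<open>i\<close> falls on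
  \<open>k\<close> is based at \<open>k - Q b i\<close>; thus each pair \<open>(b, i)\<close> in
  \<open>digits\<close> supplies exactly one bit per site.\<close>

definition bit :: "'v \<Rightarrow> nat \<Rightarrow> ('b \<times> 'v \<Rightarrow> nat set) \<Rightarrow> bool" where
  "bit k j \<omega> = (case from_nat_into digits j of (b, i) \<Rightarrow> i \<in> \<omega> (b, k - Q b i))"

definition field :: "'v \<Rightarrow> ('b \<times> 'v \<Rightarrow> nat set) \<Rightarrow> real" where
  "field k \<omega> = binary_real (\<lambda>j. bit k j \<omega>)"

lemma infinite_digits: "infinite digits"
proof
  assume "finite digits"
  then have "finite (fst ` digits)" by simp
  moreover have "b \<in> fst ` digits" for b
  proof (rule image_eqI[of _ _ "(b, 0)"])
    show "(b, 0) \<in> digits" using len[of b] by (simp add: digits_def)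
  qed simp
  then have "fst ` digits = UNIV" by blast
  ultimately show False using inf by simp
qed

lemma bij_digits: "bij_betw (from_nat_into digits) UNIV digits"
  by (rule bij_betw_from_nat_into[OF countableI_type infinite_digits])

lemma digit_index: "case from_nat_into digits j of (b, i) \<Rightarrow> i < len b"
proof -
  have "from_nat_into digits j \<in> digits" using bij_betwE[OF bij_digits] by simp
  then show ?thesis by (auto simp: digits_def)
qed

lemma bit_measurable_B:
  assumes "k \<in> S" shows "Measurable.pred (\<B> S) (bit k j)"
proof -
  obtain b i where bi: "from_nat_into digits j = (b, i)" by force
  then have i: "i < len b" using digit_index[of j] by simp
  let ?c = "(b, k - Q b i)"
  have "i \<in> idx S ?c" using i assms by (simp add: idx_def)
  then have "indicator {\<omega>. bit k j \<omega>} = (\<lambda>\<omega>. (\<lambda>v. of_bool (i \<in> v ?c) :: real) (view {?c} S \<omega>))"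
    by (auto simp: bit_def bi view_def indicator_def)
  then have "{\<omega>. bit k j \<omega>} \<in> cylinder_sets S"
    unfolding cylinder_sets_def cylinder_functions_def
    by (intro CollectI exI[of _ "\<lambda>v. of_bool (i \<in> v ?c)"] exI[of _ "{?c}"]) simp
  then show ?thesis by (simp add: pred_def \<B>_def)
qed

lemma field_measurable_B: "k \<in> S \<Longrightarrow> field k \<in> borel_measurable (\<B> S)"
  unfolding field_def[abs_def] by (intro borel_measurable_binary_real bit_measurable_B)

lemma bit_measurable: "Measurable.pred \<P> (bit k j)"
proof -
  obtain b i where bi: "from_nat_into digits j = (b, i)" by force
  show ?thesis
    using measurable_cluster_event[of "(b, k - Q b i)" "{A. i \<in> A}"] by (simp add: pred_def bit_def bi)
qed

lemma field_measurable: "field k \<in> borel_measurable \<P>"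
  unfolding field_def[abs_def] by (intro borel_measurable_binary_real bit_measurable)

text \<open>Injectivity of \<open>Q b\<close> makes different bits at one site come from different
  clusters, hence independent; each of them is a single coin of its cluster, hence fair.\<close>

lemma bits_fair: "P.prob {\<omega>\<in>space \<P>. \<forall>j<n. bit k j \<omega> = v j} = (1/2) ^ n"
proof -
  define d where "d = from_nat_into digits"
  define c where "c j = (fst (d j), k - Q (fst (d j)) (snd (d j)))" for j
  have d: "snd (d j) < len (fst (d j))" for j
    using digit_index[of j] by (simp add: d_def case_prod_unfold)
  have inj_c: "inj c"
  proof (rule injI)
    fix j j' assume eq: "c j = c j'"
    then have "fst (d j) = fst (d j')" "Q (fst (d j)) (snd (d j)) = Q (fst (d j)) (snd (d j'))"
      by (auto simp: c_def)
    then have "d j = d j'" using inj d[of j] d[of j'] by (auto simp: inj_on_def prod_eq_iff)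
    then show "j = j'" using bij_digits by (auto simp: d_def bij_betw_def inj_on_def)
  qed
  \<comment> \<open>The cylinder formula is indexed by clusters, so prescribed bits are looked up
    through the inverse of \<open>c\<close>.\<close>
  define A where "A e = {A. snd (d (inv c e)) \<in> A \<longleftrightarrow> v (inv c e)}" for e
  have A_c: "A (c j) = {A. snd (d j) \<in> A \<longleftrightarrow> v j}" for j
    by (simp add: A_def inv_f_f[OF inj_c])
  have "bit k j \<omega> = (snd (d j) \<in> \<omega> (c j))" for j \<omega>
    by (simp add: bit_def case_prod_unfold c_def d_def)
  then have "{\<omega>\<in>space \<P>. \<forall>j<n. bit k j \<omega> = v j} = {\<omega>. \<forall>e\<in>c ` {..<n}. \<omega> e \<in> A e}"
    by (auto simp: A_c)
  then have "P.prob {\<omega>\<in>space \<P>. \<forall>j<n. bit k j \<omega> = v j} =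
      (\<Prod>e\<in>c ` {..<n}. measure_pmf.prob (cluster e) (A e))"
    by (simp only: prob_cylinder finite_imageI finite_lessThan)
  also have "\<dots> = (\<Prod>j<n. measure_pmf.prob (cluster (c j)) {A. snd (d j) \<in> A \<longleftrightarrow> v j})"
    by (subst prod.reindex) (auto simp: A_c intro: inj_on_subset[OF inj_c])
  also have "\<dots> = (\<Prod>j<n. 1/2)"
    using d len by (intro prod.cong) (auto simp: cluster_def c_def cluster.prob_parity_mem)
  finally show ?thesis by simp
qed

lemma field_uniform: "distr \<P> borel (field k) = uniform_measure lborel {0..1}"
  unfolding field_def[abs_def] by (rule P.distr_binary_real_uniform[OF bit_measurable bits_fair])

text \<open>Decoding: cluster membership is almost surely a function of the field, as the lower
  bounds on correlation require.\<close>

lemma AE_digit_field: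
  assumes "i < len b"
  shows "AE \<omega> in \<P>. binary_digit (to_nat_on digits (b, i)) (field (m + Q b i) \<omega>) \<longleftrightarrow> i \<in> \<omega> (b, m)"
proof -
  have "(b, i) \<in> digits" using assms by (simp add: digits_def)
  then have "from_nat_into digits (to_nat_on digits (b, i)) = (b, i)"
    by (intro from_nat_into_to_nat_on countableI_type)
  then show ?thesis
    using P.AE_binary_digit[OF bit_measurable[of "m + Q b i"] bits_fair, of "to_nat_on digits (b, i)"]
    by (simp add: field_def bit_def)
qed

text \<open>A translation permutes the clusters of each shape, and these share one law.\<close>

lemma distr_shift: "distr \<P> \<P> (\<lambda>\<omega> c. \<omega> (fst c, snd c + m)) = \<P>"
proof -
  have "distr (\<Pi>\<^sub>M c\<in>UNIV. measure_pmf (cluster c)) (\<Pi>\<^sub>M c\<in>UNIV. measure_pmf (cluster (fst c, snd c + m)))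
      (\<lambda>\<omega>. \<lambda>c\<in>UNIV. \<omega> (fst c, snd c + m)) = (\<Pi>\<^sub>M c\<in>UNIV. measure_pmf (cluster (fst c, snd c + m)))"
    by (rule distr_PiM_reindex) (auto intro!: measure_pmf.prob_space_axioms injI simp: prod_eq_iff)
  then show ?thesis by (simp add: \<P>_def cluster_def restrict_def)
qed

lemma field_shift: "field (k + m) \<omega> = field k (\<lambda>c. \<omega> (fst c, snd c + m))"
  by (simp add: field_def bit_def case_prod_unfold algebra_simps)

end

section \<open>The law of the field\<close>

lemma (in prob_space) abs_covar_le:
  assumes "L2 M f" "L2 M g"
  shows "\<bar>covar M f g\<bar> \<le> 1 * sqrt (covar M f f * covar M g g)"
  using integral_Cauchy_Schwarz_sqrt[OF L2_diff[OF assms(1) L2_const] L2_diff[OF assms(2) L2_const],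
      of "LINT y|M. f y" "LINT y|M. g y"]
  unfolding covar_def by (simp add: power2_eq_square)

lemma abs_corr_le:
  assumes "\<bar>covar M f g\<bar> \<le> r * sqrt (covar M f f * covar M g g)" "0 \<le> r"
  shows "\<bar>corr M f g\<bar> \<le> r"
proof (cases "sqrt (covar M f f * covar M g g) = 0")
  case False
  then have "0 < sqrt (covar M f f * covar M g g)"
    by (simp add: covar_self_nonneg less_le)
  then show ?thesis using assms by (simp add: corr_def abs_divide divide_le_eq)
next
  case True
  then show ?thesis unfolding corr_def using assms(2) by (simp only: True div_by_0 abs_zero)
qed

lemma max_corr_le:
  assumes "0 \<le> r"
    and "\<And>f g. L2 M f \<Longrightarrow> f \<in> borel_measurable A \<Longrightarrow> L2 M g \<Longrightarrow> g \<in> borel_measurable B \<Longrightarrow>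
      \<bar>covar M f g\<bar> \<le> r * sqrt (covar M f f * covar M g g)"
  shows "max_corr M A B \<le> r"
  unfolding max_corr_def
proof (rule cSup_least)
  \<comment> \<open>The zero functions witness nonemptiness, which bounding a real supremum from
    above requires.\<close>
  have "\<bar>corr M (\<lambda>_. 0) (\<lambda>_. 0)\<bar> \<in> {\<bar>corr M f g\<bar> | f g.
      f \<in> borel_measurable M \<and> f \<in> borel_measurable A \<and> integrable M (\<lambda>x. (f x)\<^sup>2) \<and>
      g \<in> borel_measurable M \<and> g \<in> borel_measurable B \<and> integrable M (\<lambda>x. (g x)\<^sup>2)}"
    by (intro CollectI exI conjI refl) auto
  then show "{\<bar>corr M f g\<bar> | f g.
      f \<in> borel_measurable M \<and> f \<in> borel_measurable A \<and> integrable M (\<lambda>x. (f x)\<^sup>2) \<and>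
      g \<in> borel_measurable M \<and> g \<in> borel_measurable B \<and> integrable M (\<lambda>x. (g x)\<^sup>2)} \<noteq> {}"
    by blast
qed (use assms in \<open>auto intro!: abs_corr_le simp: L2_def\<close>)

lemma (in prob_space) max_corr_le_1: "max_corr M A B \<le> 1"
  by (rule max_corr_le) (auto intro: abs_covar_le[simplified])

lemma (in prob_space) abs_corr_le_max_corr:
  assumes "L2 M f" "f \<in> borel_measurable A" "L2 M g" "g \<in> borel_measurable B"
  shows "\<bar>corr M f g\<bar> \<le> max_corr M A B"
  unfolding max_corr_def
proof (rule cSup_upper)
  show "\<bar>corr M f g\<bar> \<in> {\<bar>corr M f g\<bar> | f g.
      f \<in> borel_measurable M \<and> f \<in> borel_measurable A \<and> integrable M (\<lambda>x. (f x)\<^sup>2) \<and>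
      g \<in> borel_measurable M \<and> g \<in> borel_measurable B \<and> integrable M (\<lambda>x. (g x)\<^sup>2)}"
    using assms unfolding L2_def by blast
  show "bdd_above {\<bar>corr M f g\<bar> | f g.
      f \<in> borel_measurable M \<and> f \<in> borel_measurable A \<and> integrable M (\<lambda>x. (f x)\<^sup>2) \<and>
      g \<in> borel_measurable M \<and> g \<in> borel_measurable B \<and> integrable M (\<lambda>x. (g x)\<^sup>2)}"
    by (rule bdd_aboveI[of _ 1]) (auto intro!: abs_corr_le[OF abs_covar_le] simp: L2_def)
qed

lemma binary_digit_measurable: "Measurable.pred borel (binary_digit j)"
  unfolding binary_digit_def[abs_def] by measurable

lemma prod_sign_mem:
  assumes "finite I"
  shows "(\<Prod>i\<in>I. if i \<in> A then - 1 else 1) = (- 1 :: real) ^ card (A \<inter> I)"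
  using assms by (simp add: prod.If_cases Int_commute)

lemma gen_sigma_measurable:
  assumes "k \<in> S" shows "(\<lambda>x. X k x) \<in> borel_measurable (gen_sigma M X S)"
proof (rule measurableI)
  fix B :: "real set" assume "B \<in> sets borel"
  then have "X k -` B \<inter> space M \<in> sigma_sets (space M) {X k -` B \<inter> space M | k B. k \<in> S \<and> B \<in> sets borel}"
    using assms by (intro sigma_sets.Basic) blast
  moreover have "{X k -` B \<inter> space M | k B. k \<in> S \<and> B \<in> sets borel} \<subseteq> Pow (space M)" by blast
  ultimately show "(\<lambda>x. X k x) -` B \<inter> space (gen_sigma M X S) \<in> sets (gen_sigma M X S)"
    unfolding gen_sigma_def by (simp add: space_measure_of sets_measure_of)
qed simp

lemma measurable_into_gen_sigma:
  assumes "\<Phi> \<in> space N \<rightarrow> space M" "\<And>k. k \<in> S \<Longrightarrow> (\<lambda>\<omega>. X k (\<Phi> \<omega>)) \<in> borel_measurable N"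
  shows "\<Phi> \<in> measurable N (gen_sigma M X S)"
  unfolding gen_sigma_def
proof (rule measurable_measure_of)
  fix y assume "y \<in> {X k -` B \<inter> space M | k B. k \<in> S \<and> B \<in> sets borel}"
  then obtain k B where y: "y = X k -` B \<inter> space M" "k \<in> S" "B \<in> sets borel" by blast
  have "\<Phi> -` y \<inter> space N = (\<lambda>\<omega>. X k (\<Phi> \<omega>)) -` B \<inter> space N"
    using assms(1) by (auto simp: y)
  then show "\<Phi> -` y \<inter> space N \<in> sets N"
    using measurable_sets[OF assms(2)[OF y(2)] y(3)] by simp
qed (use assms(1) in auto)

section \<open>The coordinate process on the canonical space\<close>

context parity_field
begin

text \<open>The theorem takes the real functions on the lattice as its sample space, so the field is
  replaced by the coordinates under its law.\<close>

definition law :: "('v \<Rightarrow> real) measure" where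
  "law = distr \<P> (\<Pi>\<^sub>M k\<in>UNIV. borel) (\<lambda>\<omega> k. field k \<omega>)"

abbreviation coord_sigma :: "'v set \<Rightarrow> ('v \<Rightarrow> real) measure" where
  "coord_sigma S \<equiv> gen_sigma law (\<lambda>k x. x k) S"

lemma fields_measurable: "(\<lambda>\<omega> k. field k \<omega>) \<in> measurable \<P> (\<Pi>\<^sub>M k\<in>UNIV. borel)"
  by (rule measurable_PiM_single') (auto simp: field_measurable)

sublocale law: prob_space law
  unfolding law_def by (rule P.prob_space_distr[OF fields_measurable])

lemma space_law [simp]: "space law = UNIV"
  by (simp add: law_def space_PiM PiE_def)

lemma prob_law_UNIV [simp]: "law.prob UNIV = 1"
  using law.prob_space by simp

lemma sets_law: "sets law = sets (\<Pi>\<^sub>M k\<in>UNIV. borel)"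
  by (simp add: law_def)

lemma coord_measurable: "(\<lambda>x. x k) \<in> borel_measurable law"
  unfolding measurable_cong_sets[OF sets_law refl] by (rule measurable_component_singleton) simp

lemma integral_law:
  "f \<in> borel_measurable law \<Longrightarrow> integral\<^sup>L law f = (LINT \<omega>|\<P>. f (\<lambda>k. field k \<omega>) :: real)"
  unfolding law_def by (subst integral_distr[OF fields_measurable]) (auto simp: measurable_distr_eq1)

lemma covar_law:
  assumes "f \<in> borel_measurable law" "g \<in> borel_measurable law"
  shows "covar law f g = covar \<P> (\<lambda>\<omega>. f (\<lambda>k. field k \<omega>)) (\<lambda>\<omega>. g (\<lambda>k. field k \<omega>))"
proof -
  have "(\<lambda>x. (f x - a) * (g x - b)) \<in> borel_measurable law" for a b
    using assms by measurable
  then show ?thesis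
    unfolding covar_def using assms by (simp add: integral_law)
qed

lemma L2_law:
  assumes "L2 law f" shows "L2 \<P> (\<lambda>\<omega>. f (\<lambda>k. field k \<omega>))"
proof -
  have "f \<in> borel_measurable (\<Pi>\<^sub>M k\<in>UNIV. borel)"
    using assms by (simp add: L2_def law_def)
  moreover from this have "(\<lambda>x. (f x)\<^sup>2) \<in> borel_measurable (\<Pi>\<^sub>M k\<in>UNIV. borel)" by measurable
  ultimately show ?thesis
    using assms fields_measurable unfolding L2_def law_def
    by (auto simp: integrable_distr_eq intro: measurable_compose)
qed

lemma fields_measurable_B: "(\<lambda>\<omega> k. field k \<omega>) \<in> measurable (\<B> S) (coord_sigma S)"
  by (rule measurable_into_gen_sigma) (auto simp: field_measurable_B)

text \<open>Composition with the field turns a function of the coordinates in \<open>S\<close> into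
  a \<open>\<B> S\<close>-measurable one and preserves covariances.\<close>

theorem law_covar_bound:
  assumes "S \<inter> T = {}" "0 \<le> r"
    and "\<And>c. idx S c \<union> idx T c = {..<len (fst c)} \<Longrightarrow> idx S c \<noteq> {} \<Longrightarrow> idx T c \<noteq> {} \<Longrightarrow>
      \<kappa> (fst c) \<le> r"
    and f: "L2 law f" "f \<in> borel_measurable (coord_sigma S)"
    and g: "L2 law g" "g \<in> borel_measurable (coord_sigma T)"
  shows "\<bar>covar law f g\<bar> \<le> r * sqrt (covar law f f * covar law g g)"
  unfolding covar_law[OF L2_D[OF f(1)] L2_D[OF g(1)]] covar_law[OF L2_D[OF f(1)] L2_D[OF f(1)]]
    covar_law[OF L2_D[OF g(1)] L2_D[OF g(1)]]
  by (rule covar_bound[OF assms(1-3)])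
    (use f g L2_law measurable_compose[OF fields_measurable_B] in blast)+

theorem law_max_corr_le:
  assumes "S \<inter> T = {}" "0 \<le> r"
    and "\<And>c. idx S c \<union> idx T c = {..<len (fst c)} \<Longrightarrow> idx S c \<noteq> {} \<Longrightarrow> idx T c \<noteq> {} \<Longrightarrow>
      \<kappa> (fst c) \<le> r"
  shows "max_corr law (coord_sigma S) (coord_sigma T) \<le> r"
  by (rule max_corr_le[OF assms(2)]) (rule law_covar_bound[OF assms])

section \<open>Lower bounds by Walsh functions\<close>

text \<open>The sign \<open>(-1) ^ card (\<omega> c \<inter> I)\<close>, decoded from the field
  values so that it depends only on coordinates; for members \<open>I\<close> of the cluster the two
  agree almost surely.\<close>

definition walsh :: "nat set \<Rightarrow> 'b \<times> 'v \<Rightarrow> ('v \<Rightarrow> real) \<Rightarrow> real" where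
  "walsh I c x = (\<Prod>i\<in>I. if binary_digit (to_nat_on digits (fst c, i)) (x (snd c + Q (fst c) i)) then - 1 else 1)"

lemma walsh_measurable:
  assumes "\<And>i. i \<in> I \<Longrightarrow> (\<lambda>x. x (snd c + Q (fst c) i)) \<in> borel_measurable M"
  shows "walsh I c \<in> borel_measurable M"
  unfolding walsh_def[abs_def]
proof (rule borel_measurable_prod)
  fix i assume "i \<in> I"
  have "Measurable.pred M (\<lambda>x. binary_digit (to_nat_on digits (fst c, i)) (x (snd c + Q (fst c) i)))"
    by (rule measurable_compose[OF assms[OF \<open>i \<in> I\<close>] binary_digit_measurable])
  then show "(\<lambda>x. if binary_digit (to_nat_on digits (fst c, i)) (x (snd c + Q (fst c) i)) then - 1 else 1 :: real)
      \<in> borel_measurable M"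
    by measurable
qed

lemma abs_walsh: "\<bar>walsh I c x\<bar> = 1"
  unfolding walsh_def abs_prod by (rule prod.neutral) auto

lemma L2_walsh: "L2 law (walsh I c)"
  by (rule law.L2_bounded[of _ 1]) (auto simp: abs_walsh walsh_measurable coord_measurable)

lemma AE_walsh:
  assumes "I \<subseteq> {..<len (fst c)}"
  shows "AE \<omega> in \<P>. walsh I c (\<lambda>k. field k \<omega>) = (- 1) ^ card (\<omega> c \<inter> I)"
proof -
  have fin: "finite I" using assms by (rule finite_subset) simp
  have "AE \<omega> in \<P>. \<forall>i\<in>I. binary_digit (to_nat_on digits (fst c, i)) (field (snd c + Q (fst c) i) \<omega>) \<longleftrightarrow> i \<in> \<omega> c"
    using AE_digit_field[of _ "fst c" "snd c"] assms by (intro AE_finite_allI[OF fin]) auto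
  then show ?thesis
  proof (rule AE_mp, intro AE_I2 impI)
    fix \<omega> assume "\<forall>i\<in>I. binary_digit (to_nat_on digits (fst c, i)) (field (snd c + Q (fst c) i) \<omega>) \<longleftrightarrow> i \<in> \<omega> c"
    then have "walsh I c (\<lambda>k. field k \<omega>) = (\<Prod>i\<in>I. if i \<in> \<omega> c then - 1 else 1)"
      unfolding walsh_def by (intro prod.cong) auto
    then show "walsh I c (\<lambda>k. field k \<omega>) = (- 1) ^ card (\<omega> c \<inter> I)"
      by (simp add: prod_sign_mem[OF fin])
  qed
qed

lemma integral_cluster:
  "(LINT \<omega>|\<P>. h (\<omega> c)) = (measure_pmf.expectation (cluster c) h :: real)"
proof -
  have "(LINT A|distr \<P> (measure_pmf (cluster c)) (\<lambda>\<omega>. \<omega> c). h A) = (LINT \<omega>|\<P>. h (\<omega> c))"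
    by (rule integral_distr) (auto simp: \<P>_def)
  moreover have "distr \<P> (measure_pmf (cluster c)) (\<lambda>\<omega>. \<omega> c) = measure_pmf (cluster c)"
    unfolding \<P>_def by (rule product.PiM_component) simp
  ultimately show ?thesis by simp
qed

lemma expectation_walsh:
  assumes "I \<subseteq> {..<len (fst c)}" "I \<noteq> {}"
  shows "(LINT x|law. walsh I c x) = (if I = {..<len (fst c)} then \<kappa> (fst c) else 0)"
proof -
  have m: "walsh I c \<in> borel_measurable law" by (rule L2_D[OF L2_walsh])
  have "(\<lambda>\<omega>. walsh I c (\<lambda>k. field k \<omega>)) \<in> borel_measurable \<P>"
    by (rule L2_D[OF L2_law[OF L2_walsh]])
  moreover have "(\<lambda>\<omega>. (- 1 :: real) ^ card (\<omega> c \<inter> I)) \<in> borel_measurable \<P>"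
  proof (rule measurable_compose[of "\<lambda>\<omega>. \<omega> c" _ "measure_pmf (cluster c)"])
    show "(\<lambda>\<omega>. \<omega> c) \<in> measurable \<P> (measure_pmf (cluster c))"
      unfolding \<P>_def by (rule measurable_component_singleton) simp
  qed simp
  ultimately have "(LINT x|law. walsh I c x) = (LINT \<omega>|\<P>. (- 1) ^ card (\<omega> c \<inter> I))"
    unfolding integral_law[OF m] by (rule integral_cong_AE[OF _ _ AE_walsh[OF assms(1)]])
  then show ?thesis
    unfolding integral_cluster[where h = "\<lambda>A. (- 1) ^ card (A \<inter> I)"]
    by (simp add: cluster_def cluster.expectation_parity_sign[OF assms])
qed

lemma walsh_Un: "I \<inter> J = {} \<Longrightarrow> finite I \<Longrightarrow> finite J \<Longrightarrow> walsh I c x * walsh J c x = walsh (I \<union> J) c x"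
  unfolding walsh_def by (rule prod.union_disjoint[symmetric])

text \<open>Signs have square 1, and those over proper parts have mean 0; the product of the two is
  the sign over the whole cluster, whose mean is the bias.\<close>

lemma corr_walsh:
  assumes "I \<union> J = {..<len (fst c)}" "I \<inter> J = {}" "I \<noteq> {}" "J \<noteq> {}"
  shows "corr law (walsh I c) (walsh J c) = \<kappa> (fst c)"
proof -
  have sub: "I \<subseteq> {..<len (fst c)}" "J \<subseteq> {..<len (fst c)}" and ne: "I \<noteq> {..<len (fst c)}" "J \<noteq> {..<len (fst c)}"
    using assms by auto
  have fin: "finite I" "finite J" using sub by (auto simp: finite_subset)
  have E0: "(LINT x|law. walsh I c x) = 0" "(LINT x|law. walsh J c x) = 0"
    using expectation_walsh[OF sub(1) assms(3)] expectation_walsh[OF sub(2) assms(4)] ne by auto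
  have "walsh I c x * walsh I c x = 1" for I x
    using abs_walsh[of I c x] by (metis abs_mult_self_eq mult_1)
  then have var: "covar law (walsh I c) (walsh I c) = 1" "covar law (walsh J c) (walsh J c) = 1"
    by (simp_all add: law.covar_eq L2_walsh E0 law.prob_space)
  have "covar law (walsh I c) (walsh J c) = (LINT x|law. walsh (I \<union> J) c x)"
    by (simp add: law.covar_eq L2_walsh E0 walsh_Un assms fin)
  also have "\<dots> = \<kappa> (fst c)"
    using expectation_walsh[of "I \<union> J" c] assms(1,3) by auto
  finally show ?thesis by (simp add: corr_def var)
qed

theorem law_max_corr_ge:
  assumes "S \<inter> T = {}" "idx S c \<union> idx T c = {..<len (fst c)}" "idx S c \<noteq> {}" "idx T c \<noteq> {}"
  shows "\<kappa> (fst c) \<le> max_corr law (coord_sigma S) (coord_sigma T)"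
proof -
  have "idx S c \<inter> idx T c = {}" using assms(1) by (auto simp: idx_def)
  then have "corr law (walsh (idx S c) c) (walsh (idx T c) c) = \<kappa> (fst c)"
    using assms by (intro corr_walsh)
  moreover have "\<bar>corr law (walsh (idx S c) c) (walsh (idx T c) c)\<bar> \<le>
      max_corr law (coord_sigma S) (coord_sigma T)"
    by (intro law.abs_corr_le_max_corr L2_walsh walsh_measurable gen_sigma_measurable[where X = "\<lambda>k x. x k"])
      (auto simp: idx_def)
  ultimately show ?thesis using bias[of "fst c"] by simp
qed

section \<open>Marginals, stationarity and independence\<close>

lemma law_uniform: "distr law borel (\<lambda>x. x k) = uniform_measure lborel {0..1}"
proof -
  have "distr law borel (\<lambda>x. x k) = distr \<P> borel ((\<lambda>x. x k) \<circ> (\<lambda>\<omega> k. field k \<omega>))"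
    unfolding law_def by (rule distr_distr[OF _ fields_measurable]) simp
  then show ?thesis by (simp add: comp_def field_uniform)
qed

text \<open>Translating the sites amounts to translating the clusters, which preserves \<P>.\<close>

lemma law_stationary:
  "distr law (PiM J (\<lambda>_. borel)) (\<lambda>x. \<lambda>k\<in>J. x (k + m)) = distr law (PiM J (\<lambda>_. borel)) (\<lambda>x. \<lambda>k\<in>J. x k)"
proof -
  let ?N = "PiM J (\<lambda>_. borel) :: ('v \<Rightarrow> real) measure"
  let ?s = "\<lambda>\<omega> c. \<omega> (fst c, snd c + m)"
  have F: "(\<lambda>\<omega>. \<lambda>k\<in>J. field k \<omega>) \<in> measurable \<P> ?N"
    by (rule measurable_restrict) (rule field_measurable)
  have s: "?s \<in> measurable \<P> \<P>"
  proof -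
    have "?s \<in> measurable \<P> (\<Pi>\<^sub>M c\<in>UNIV. measure_pmf (cluster c))"
    proof (rule measurable_PiM_single')
      fix c
      have "(\<lambda>\<omega>. \<omega> (fst c, snd c + m)) \<in> measurable \<P> (measure_pmf (cluster (fst c, snd c + m)))"
        unfolding \<P>_def by (rule measurable_component_singleton) simp
      then show "(\<lambda>\<omega>. \<omega> (fst c, snd c + m)) \<in> measurable \<P> (measure_pmf (cluster c))"
        by (simp add: cluster_def)
    qed auto
    then show ?thesis by (simp add: \<P>_def)
  qed
  have "distr law ?N (\<lambda>x. \<lambda>k\<in>J. x (t k)) = distr \<P> ?N (\<lambda>\<omega>. \<lambda>k\<in>J. field (t k) \<omega>)" for t :: "'v \<Rightarrow> 'v"
  proof -
    have "(\<lambda>x. \<lambda>k\<in>J. x (t k)) \<in> measurable (\<Pi>\<^sub>M k\<in>UNIV. borel) ?N"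
      by (rule measurable_restrict) (rule measurable_component_singleton, simp)
    then show ?thesis
      unfolding law_def by (subst distr_distr[OF _ fields_measurable]) (simp_all add: comp_def)
  qed
  note law_distr = this
  have "distr law ?N (\<lambda>x. \<lambda>k\<in>J. x (k + m)) = distr \<P> ?N ((\<lambda>\<omega>. \<lambda>k\<in>J. field k \<omega>) \<circ> ?s)"
    unfolding law_distr by (simp add: field_shift comp_def)
  also have "\<dots> = distr (distr \<P> \<P> ?s) ?N (\<lambda>\<omega>. \<lambda>k\<in>J. field k \<omega>)"
    by (rule distr_distr[OF F s, symmetric])
  also have "\<dots> = distr law ?N (\<lambda>x. \<lambda>k\<in>J. x k)"
    unfolding distr_shift law_distr[of "\<lambda>k. k"] ..
  finally show ?thesis .
qed

text \<open>Fewer sites than a cluster has points cannot cover a cluster, so the covariance bound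
  holds with constant 0.\<close>

lemma law_prob_Int:
  assumes K: "finite K" "k \<notin> K" "\<And>b. card (insert k K) < len b" and B: "\<And>j. B j \<in> sets borel"
  shows "law.prob {x. \<forall>j\<in>insert k K. x j \<in> B j} = law.prob {x. x k \<in> B k} * law.prob {x. \<forall>j\<in>K. x j \<in> B j}"
proof -
  let ?E = "\<lambda>K. {x. \<forall>j\<in>K. x j \<in> B j}"
  have ev: "?E J \<in> sets (coord_sigma J)" if "finite J" for J
  proof -
    have "(\<lambda>x. x j) -` B j \<inter> space (coord_sigma J) \<in> sets (coord_sigma J)" if "j \<in> J" for j
      using gen_sigma_measurable[OF that, of "\<lambda>k x. x k" law] B by (rule measurable_sets)
    then have "space (coord_sigma J) - (\<Union>j\<in>J. space (coord_sigma J) - ((\<lambda>x. x j) -` B j \<inter> space (coord_sigma J))) \<in> sets (coord_sigma J)"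
      using that by (intro sets.Diff sets.top sets.finite_UN) auto
    moreover have "space (coord_sigma J) = UNIV" by (simp add: gen_sigma_def)
    ultimately show ?thesis by (simp add: Diff_eq vimage_def Collect_ball_eq Compl_eq)
  qed
  have ev': "?E J \<in> law.events" if "finite J" for J
  proof -
    have "?E J = space law - (\<Union>j\<in>J. space law - ((\<lambda>x. x j) -` B j \<inter> space law))" by auto
    also have "\<dots> \<in> law.events"
      using that B measurable_sets[OF coord_measurable] by (intro sets.Diff sets.top sets.finite_UN) auto
    finally show ?thesis .
  qed
  let ?f = "indicator (?E {k}) :: _ \<Rightarrow> real" and ?g = "indicator (?E K) :: _ \<Rightarrow> real"
  have L: "L2 law ?f" "L2 law ?g"
    using ev'[of "{k}"] ev'[of K] K(1) by (auto intro!: law.L2_bounded[of _ 1] simp: indicator_def)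
  have "\<bar>covar law ?f ?g\<bar> \<le> 0 * sqrt (covar law ?f ?f * covar law ?g ?g)"
  proof (rule law_covar_bound[of "{k}" K])
    fix c assume "idx {k} c \<union> idx K c = {..<len (fst c)}"
    then have "(\<lambda>i. snd c + Q (fst c) i) ` {..<len (fst c)} \<subseteq> insert k K"
      by (auto simp: idx_def)
    moreover have "inj_on (\<lambda>i. snd c + Q (fst c) i) {..<len (fst c)}"
      using inj[of "fst c"] by (simp add: inj_on_def)
    ultimately have "len (fst c) \<le> card (insert k K)"
      using card_inj_on_le[of "\<lambda>i. snd c + Q (fst c) i" "{..<len (fst c)}" "insert k K"] K(1) by simp
    then show "\<kappa> (fst c) \<le> 0" using K(3)[of "fst c"] by simp
  qed (use K ev[of "{k}"] ev[of K] L in \<open>auto intro!: borel_measurable_indicator\<close>)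
  then have "(LINT x|law. ?f x * ?g x) = (LINT x|law. ?f x) * (LINT x|law. ?g x)"
    using L by (simp add: law.covar_eq)
  moreover have "?f x * ?g x = indicator (?E (insert k K)) x" for x
    by (auto simp: indicator_def)
  ultimately show ?thesis by simp
qed

lemma law_prob_finite:
  assumes "finite K" "\<And>b. card K < len b" "\<And>j. B j \<in> sets borel"
  shows "law.prob {x. \<forall>j\<in>K. x j \<in> B j} = (\<Prod>j\<in>K. law.prob {x. x j \<in> B j})"
  using assms(1,2)
proof (induction K)
  case empty
  then show ?case using law.prob_space by simp
next
  case (insert k K)
  have "card K < len b" for b
    using insert.prems[of b] insert.hyps by simp
  then show ?case
    using law_prob_Int[of K k B, OF insert.hyps insert.prems assms(3)] insert by simp
qed

theorem law_indep:
  assumes K: "finite K" "\<And>b. card K < len b"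
  shows "law.indep_vars (\<lambda>_. borel) (\<lambda>k x. x k) K"
  unfolding law.indep_vars_def2 law.indep_sets_def
proof (intro conjI ballI allI impI)
  fix J A assume J: "J \<subseteq> K" "J \<noteq> {}" "finite J"
    and A: "A \<in> (\<Pi> j\<in>J. {(\<lambda>x. x j) -` A \<inter> space law | A. A \<in> sets borel})"
  have "\<exists>B. j \<in> J \<longrightarrow> (B \<in> sets borel \<and> A j = {x. x j \<in> B})" for j
    using A by (force simp: Pi_iff vimage_def)
  then obtain B' where B': "\<And>j. j \<in> J \<Longrightarrow> B' j \<in> sets borel \<and> A j = {x. x j \<in> B' j}" by metis
  \<comment> \<open>Extended by the Borel set \<open>{}\<close>, since
    \<open>law_prob_finite\<close> asks for measurability at every index.\<close>
  define B where "B j = (if j \<in> J then B' j else {})" for j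
  have B: "B j \<in> sets borel" for j using B' by (simp add: B_def)
  have A_B: "A j = {x. x j \<in> B j}" if "j \<in> J" for j using B' that by (simp add: B_def)
  have "card J < len b" for b
    using card_mono[OF K(1) J(1)] K(2)[of b] by simp
  then have "law.prob {x. \<forall>j\<in>J. x j \<in> B j} = (\<Prod>j\<in>J. law.prob {x. x j \<in> B j})"
    by (intro law_prob_finite J B)
  moreover have "(\<Inter>j\<in>J. A j) = {x. \<forall>j\<in>J. x j \<in> B j}" using A_B by auto
  ultimately show "law.prob (\<Inter>j\<in>J. A j) = (\<Prod>j\<in>J. law.prob (A j))"
    using A_B by simp
qed (use measurable_sets[OF coord_measurable] coord_measurable in auto)

end

section \<open>Choice of the clusters\<close>

text \<open>Blocks \<open>(True, n)\<close> have bias 1 and yield \<open>\<rho>* = 1\<close> and \<open>\<rho>(1) = \<rho>'(1) = 1\<close>; blocks \<open>(False, n)\<close> have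
  bias \<open>c (n + 2)\<close> and yield \<open>\<rho> = \<rho>' = c\<close> at distance \<open>n + 2\<close>.\<close>

definition scale :: "bool \<times> nat \<Rightarrow> nat" where
  "scale b = (if fst b then 1 else snd b + 2)"

text \<open>The term \<open>N\<close> makes every cluster larger than \<open>N\<close>; the term
  \<open>2 * snd b\<close> makes the halves long enough to be separated by norm distance
  \<open>snd b\<close> at scale 1.\<close>

definition half_size :: "nat \<Rightarrow> bool \<times> nat \<Rightarrow> nat" where
  "half_size N b = 2 * snd b + N"

definition block_bias :: "(nat \<Rightarrow> real) \<Rightarrow> bool \<times> nat \<Rightarrow> real" where
  "block_bias c b = (if fst b then 1 else c (snd b + 2))"

text \<open>A cluster is a dilated pair of diagonal segments, the first increasing and the second decreasing
  relative to the coordinate \<open>u0\<close>. The segments are far apart in norm, yet their union projects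
  onto an interval (times the scale) in every coordinate direction.\<close>

definition base_coord :: "nat \<Rightarrow> bool \<Rightarrow> nat \<Rightarrow> int" where
  "base_coord L first i = (if first \<or> i < L then int i else int L - 1 - int i)"

definition block_point :: "nat \<Rightarrow> 'd::finite \<Rightarrow> bool \<times> nat \<Rightarrow> nat \<Rightarrow> int^'d" where
  "block_point N u0 b i = (\<chi> u. int (scale b) * base_coord (half_size N b) (u = u0) i)"

section \<open>Geometry of the clusters\<close>

lemma base_coord_range:
  "\<exists>lo hi. base_coord L f ` {..<2 * L} = {lo..hi}"
proof (cases f)
  case True
  have "base_coord L f ` {..<2 * L} = {0..2 * int L - 1}"
  proof (intro set_eqI iffI)
    fix y assume "y \<in> {0..2 * int L - 1}"
    then show "y \<in> base_coord L f ` {..<2 * L}"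
      using True by (intro image_eqI[of _ _ "nat y"]) (auto simp: base_coord_def)
  qed (use True in \<open>auto simp: base_coord_def\<close>)
  then show ?thesis by blast
next
  case False
  have "base_coord L f ` {..<2 * L} = {- int L..int L - 1}"
  proof (intro set_eqI iffI)
    fix y assume y: "y \<in> {- int L..int L - 1}"
    show "y \<in> base_coord L f ` {..<2 * L}"
    proof (cases "0 \<le> y")
      case True
      then show ?thesis
        using y False by (intro image_eqI[of _ _ "nat y"]) (auto simp: base_coord_def)
    next
      case neg: False
      then show ?thesis
        using y False by (intro image_eqI[of _ _ "nat (int L - 1 - y)"]) (auto simp: base_coord_def)
    qed
  qed (use False in \<open>auto simp: base_coord_def split: if_splits\<close>)
  then show ?thesis by blast
qed

lemma int_interval_constant:
  fixes P :: "int \<Rightarrow> bool"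
  assumes step: "\<And>y. lo \<le> y \<Longrightarrow> y < hi \<Longrightarrow> P y = P (y + 1)" and "lo \<le> x" "x \<le> hi"
  shows "P x = P lo"
  using assms(2,3)
proof (induction x rule: int_ge_induct)
  case (step y)
  then show ?case using assms(1)[of y] by simp
qed simp

lemma abs_coord_le_lat_norm: "real_of_int \<bar>k $ u\<bar> \<le> lat_norm k"
proof -
  have "(real_of_int (k $ u))\<^sup>2 \<le> (\<Sum>u\<in>UNIV. (real_of_int (k $ u))\<^sup>2)"
    by (rule member_le_sum) auto
  then have "sqrt ((real_of_int (k $ u))\<^sup>2) \<le> lat_norm k"
    unfolding lat_norm_def by (rule real_sqrt_le_mono)
  then show ?thesis by simp
qed

lemma Sup_real_eqI:
  fixes v :: real
  assumes "x \<in> A" "v \<le> x" "\<And>y. y \<in> A \<Longrightarrow> y \<le> v"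
  shows "Sup A = v"
  using assms by (metis antisym cSup_eq_maximum)

section \<open>Evaluation of the three coefficients\<close>

locale mixing_field =
  fixes N :: nat and c :: "nat \<Rightarrow> real" and u0 v0 :: "'d::finite"
  assumes N: "2 \<le> N" and c: "\<And>n. 1 \<le> n \<Longrightarrow> 0 \<le> c n \<and> c n \<le> 1"
    and c_mono: "\<And>m n. 1 \<le> m \<Longrightarrow> m \<le> n \<Longrightarrow> c n \<le> c m" and uv: "u0 \<noteq> v0"
begin

lemma inj_block_point: "inj (block_point N u0 b)"
proof (rule injI)
  fix i j assume "block_point N u0 b i = block_point N u0 b j"
  then have "block_point N u0 b i $ u0 = block_point N u0 b j $ u0" by simp
  then show "i = j" by (simp add: block_point_def base_coord_def scale_def split: if_splits)
qed

sublocale parity_field "\<lambda>b. 2 * half_size N b" "block_bias c" "block_point N u0"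
proof
  show "inj_on (block_point N u0 b) {..<2 * half_size N b}" for b
    by (rule inj_on_subset[OF inj_block_point]) simp
  show "infinite (UNIV :: (bool \<times> nat) set)"
    by (simp add: finite_prod)
qed (use N c in \<open>auto simp: half_size_def block_bias_def\<close>)

lemma block_coord: "block_point N u0 b i $ u = int (scale b) * base_coord (half_size N b) (u = u0) i"
  by (simp add: block_point_def)

text \<open>Discrete connectedness: the projection is an arithmetic progression with step below
  \<open>n\<close>, so neighbours cannot lie one in \<open>G\<close> and the other in
  \<open>H\<close>, and membership in \<open>G\<close> is constant along it.\<close>

lemma no_split:
  assumes GH: "G \<inter> H = {}" "\<And>g h. g \<in> G \<Longrightarrow> h \<in> H \<Longrightarrow> int n \<le> \<bar>g - h\<bar>" and n: "scale (fst e) < n"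
    and cover: "idx {k. k $ u \<in> G} e \<union> idx {k. k $ u \<in> H} e = {..<2 * half_size N (fst e)}"
    and ne: "idx {k. k $ u \<in> G} e \<noteq> {}" "idx {k. k $ u \<in> H} e \<noteq> {}"
  shows False
proof -
  let ?L = "half_size N (fst e)"
  let ?p = "base_coord ?L (u = u0)"
  define s where "s = int (scale (fst e))"
  define pos where "pos y = snd e $ u + s * y" for y
  have coord: "(snd e + block_point N u0 (fst e) i) $ u = pos (?p i)" for i
    by (simp add: pos_def block_coord s_def)
  have idx: "i \<in> idx {k. k $ u \<in> A} e \<longleftrightarrow> i < 2 * ?L \<and> pos (?p i) \<in> A" for i A
    by (auto simp: idx_def coord[symmetric])
  obtain lo hi where range: "?p ` {..<2 * ?L} = {lo..hi}"
    using base_coord_range by blast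
  have in_GH: "pos y \<in> G \<or> pos y \<in> H" if "lo \<le> y" "y \<le> hi" for y
  proof -
    have "y \<in> ?p ` {..<2 * ?L}" using that by (simp add: range)
    then obtain i where i: "i < 2 * ?L" "y = ?p i" by auto
    then have "i \<in> idx {k. k $ u \<in> G} e \<union> idx {k. k $ u \<in> H} e" unfolding cover by simp
    then show ?thesis using i by (auto simp: idx)
  qed
  have step: "(pos y \<in> G) = (pos (y + 1) \<in> G)" if "lo \<le> y" "y < hi" for y
  proof -
    have "\<bar>pos y - pos (y + 1)\<bar> < int n" "\<bar>pos (y + 1) - pos y\<bar> < int n"
      using n by (simp_all add: pos_def s_def algebra_simps)
    then show ?thesis
      using GH(2)[of "pos y" "pos (y + 1)"] GH(2)[of "pos (y + 1)" "pos y"]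
        in_GH[of y] in_GH[of "y + 1"] that by fastforce
  qed
  obtain i j where ij: "i < 2 * ?L" "pos (?p i) \<in> G" "j < 2 * ?L" "pos (?p j) \<in> H"
    using ne idx by blast
  then have "?p i \<in> {lo..hi}" "?p j \<in> {lo..hi}" unfolding range[symmetric] by auto
  then have "(pos (?p i) \<in> G) = (pos lo \<in> G)" "(pos (?p j) \<in> G) = (pos lo \<in> G)"
    using int_interval_constant[of lo hi "\<lambda>y. pos y \<in> G" "?p i", OF step]
      int_interval_constant[of lo hi "\<lambda>y. pos y \<in> G" "?p j", OF step] by auto
  then show False using ij GH(1) by blast
qed

text \<open>A split cluster has scale at least \<open>n \<ge> 2\<close>, which excludes the bias-1
  blocks; for the remaining ones monotonicity of \<open>c\<close> bounds the bias.\<close>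

lemma max_corr_strip_le:
  assumes GH: "G \<inter> H = {}" "\<And>g h. g \<in> G \<Longrightarrow> h \<in> H \<Longrightarrow> int n \<le> \<bar>g - h\<bar>" and n: "2 \<le> n"
  shows "max_corr law (coord_sigma {k. k $ u \<in> G}) (coord_sigma {k. k $ u \<in> H}) \<le> c n"
proof (rule law_max_corr_le)
  show "{k. k $ u \<in> G} \<inter> {k. k $ u \<in> H} = {}" using GH(1) by auto
  show "0 \<le> c n" using c[of n] n by simp
  fix e assume "idx {k. k $ u \<in> G} e \<union> idx {k. k $ u \<in> H} e = {..<2 * half_size N (fst e)}"
    "idx {k. k $ u \<in> G} e \<noteq> {}" "idx {k. k $ u \<in> H} e \<noteq> {}"
  then have "n \<le> scale (fst e)"
    using no_split[OF GH, of e u] by (meson not_le)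
  then have "\<not> fst (fst e)" "n \<le> snd (fst e) + 2" using n by (auto simp: scale_def split: if_splits)
  then show "block_bias c (fst e) \<le> c n" using c_mono[of n] n by (simp add: block_bias_def)
qed

text \<open>In direction \<open>u0\<close> the cluster based at 0 projects to the multiples
  \<open>n * i\<close>, so these half-spaces cut it just after its first point.\<close>

lemma max_corr_half_spaces_ge:
  assumes "scale b = n" "1 \<le> n"
  shows "block_bias c b \<le> max_corr law (coord_sigma {k. k $ u0 \<le> 0}) (coord_sigma {k. k $ u0 \<ge> 0 + int n})"
proof -
  have coord: "((0 :: int^'d) + block_point N u0 b i) $ u0 = int n * int i" for i
    by (simp add: block_coord base_coord_def assms)
  have S: "idx {k. k $ u0 \<le> 0} (b, 0) = {0}"
  proof -
    have "0 < half_size N b" using N by (simp add: half_size_def)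
    then show ?thesis
      using assms unfolding idx_def mem_Collect_eq fst_conv snd_conv coord
      by (auto simp: mult_le_0_iff)
  qed
  have T: "idx {k. k $ u0 \<ge> 0 + int n} (b, 0) = {1..<2 * half_size N b}"
  proof -
    have "0 + int n \<le> int n * int i \<longleftrightarrow> 1 \<le> i" for i
      using assms(2) by (cases i) (simp_all add: algebra_simps)
    then have "i \<in> idx {k. k $ u0 \<ge> 0 + int n} (b, 0) \<longleftrightarrow> i \<in> {1..<2 * half_size N b}" for i
      unfolding idx_def mem_Collect_eq fst_conv snd_conv coord atLeastLessThan_iff by blast
    then show ?thesis by blast
  qed
  have "{k :: int^'d. k $ u0 \<le> 0} \<inter> {k. k $ u0 \<ge> 0 + int n} = {}" using assms(2) by auto
  moreover have "{0} \<union> {1..<2 * half_size N b} = {..<2 * half_size N b}" "{1..<2 * half_size N b} \<noteq> {}"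
    using N by (auto simp: half_size_def)
  ultimately show ?thesis
    using law_max_corr_ge[of "{k. k $ u0 \<le> 0}" "{k. k $ u0 \<ge> 0 + int n}" "(b, 0)", unfolded S T fst_conv]
    by blast
qed

text \<open>The witnesses are the two diagonal segments of one bias-1 cluster, which together
  exhaust it.\<close>

lemma max_corr_star_ge:
  fixes n :: nat
  defines "L \<equiv> half_size N (True, n)"
  defines "S \<equiv> block_point N u0 (True, n) ` {..<L}" and "T \<equiv> block_point N u0 (True, n) ` {L..<2 * L}"
  shows "max_corr law (coord_sigma S) (coord_sigma T) = 1"
    and "S \<inter> T = {}" "S \<noteq> {}" "T \<noteq> {}" and "\<And>s t. s \<in> S \<Longrightarrow> t \<in> T \<Longrightarrow> real n \<le> lat_norm (s - t)"
proof -
  have L: "2 \<le> L" "2 * n \<le> L" using N by (simp_all add: L_def half_size_def)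
  show disj: "S \<inter> T = {}"
    unfolding S_def T_def using image_Int[OF inj_block_point, of "(True, n)" "{..<L}" "{L..<2 * L}"] by auto
  show "S \<noteq> {}" "T \<noteq> {}" using L by (auto simp: S_def T_def lessThan_empty_iff bot_nat_def)
  have "idx S ((True, n), 0) = {..<L}" "idx T ((True, n), 0) = {L..<2 * L}"
    using L inj_block_point[of "(True, n)"]
    by (auto simp: idx_def S_def T_def L_def[symmetric] inj_image_mem_iff)
  then have "block_bias c (True, n) \<le> max_corr law (coord_sigma S) (coord_sigma T)"
    using law_max_corr_ge[OF disj, of "((True, n), 0)"] L
    by (auto simp: L_def[symmetric] ivl_disj_un lessThan_empty_iff bot_nat_def)
  then show "max_corr law (coord_sigma S) (coord_sigma T) = 1"
    using law.max_corr_le_1[of "coord_sigma S" "coord_sigma T"] by (simp add: block_bias_def)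
  fix s t assume "s \<in> S" "t \<in> T"
  then obtain i j where ij: "i < L" "L \<le> j" "j < 2 * L"
    "s = block_point N u0 (True, n) i" "t = block_point N u0 (True, n) j"
    by (auto simp: S_def T_def)
  have "(s - t) $ u0 = int i - int j" "(s - t) $ v0 = int i + int j + 1 - int L"
    using ij uv by (simp_all add: block_coord base_coord_def scale_def L_def[symmetric])
  \<comment> \<open>If \<open>j - i < n\<close>, then \<open>i > L - n\<close>, and
    \<open>2 * n \<le> L\<close> makes the difference in coordinate \<open>v0\<close> at least
    \<open>n\<close>.\<close>
  then have "int n \<le> \<bar>(s - t) $ u0\<bar> \<or> int n \<le> \<bar>(s - t) $ v0\<bar>"
    using ij L by linarith
  then have "\<exists>u. real n \<le> real_of_int \<bar>(s - t) $ u\<bar>"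
    by (metis of_int_le_iff of_int_of_nat_eq)
  then show "real n \<le> lat_norm (s - t)"
    using abs_coord_le_lat_norm order_trans by blast
qed

lemma rho_star_law: "rho_star law (\<lambda>k x. x k) n = 1"
  unfolding rho_star_def
proof (rule Sup_real_eqI)
  let ?L = "half_size N (True, n)"
  let ?S = "block_point N u0 (True, n) ` {..<?L}" and ?T = "block_point N u0 (True, n) ` {?L..<2 * ?L}"
  show "max_corr law (coord_sigma ?S) (coord_sigma ?T) \<in> {max_corr law (coord_sigma S) (coord_sigma T) |
      S T. S \<noteq> {} \<and> T \<noteq> {} \<and> S \<inter> T = {} \<and> (\<forall>s\<in>S. \<forall>t\<in>T. real n \<le> lat_norm (s - t))}"
    using max_corr_star_ge(2-4)[of n] max_corr_star_ge(5)[where n = n] by blast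
  show "1 \<le> max_corr law (coord_sigma ?S) (coord_sigma ?T)"
    using max_corr_star_ge(1)[of n] by simp
qed (use law.max_corr_le_1 in auto)

text \<open>Half-spaces are strips with \<open>G\<close> and \<open>H\<close> rays, so the two
  coefficients share the upper bound on strips and the half-space pair that attains it.\<close>

lemma rho_law:
  assumes n: "1 \<le> n" and b: "scale b = n" "block_bias c b = v"
    and le: "\<And>u G H. G \<inter> H = {} \<Longrightarrow> (\<And>g h. g \<in> G \<Longrightarrow> h \<in> H \<Longrightarrow> int n \<le> \<bar>g - h\<bar>) \<Longrightarrow>
      max_corr law (coord_sigma {k. k $ u \<in> G}) (coord_sigma {k. k $ u \<in> H}) \<le> v"
  shows "rho_coef law (\<lambda>k x. x k) n = v" "rho_prime law (\<lambda>k x. x k) n = v"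
proof -
  let ?m = "max_corr law (coord_sigma {k. k $ u0 \<le> 0}) (coord_sigma {k. k $ u0 \<ge> 0 + int n})"
  have ge: "v \<le> ?m" using max_corr_half_spaces_ge[OF b(1) n] b(2) by simp
  show "rho_coef law (\<lambda>k x. x k) n = v"
    unfolding rho_coef_def
  proof (rule Sup_real_eqI[OF _ ge])
    show "?m \<in> {max_corr law (coord_sigma {k. k $ u \<le> j}) (coord_sigma {k. j + int n \<le> k $ u}) | j u. True}"
      by blast
    fix y assume "y \<in> {max_corr law (coord_sigma {k. k $ u \<le> j}) (coord_sigma {k. j + int n \<le> k $ u}) | j u. True}"
    then obtain j u where y: "y = max_corr law (coord_sigma {k. k $ u \<le> j}) (coord_sigma {k. j + int n \<le> k $ u})"
      by blast
    show "y \<le> v"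
      using le[of "{..j}" "{j + int n..}" u] n by (fastforce simp: y)
  qed
  show "rho_prime law (\<lambda>k x. x k) n = v"
    unfolding rho_prime_def
  proof (rule Sup_real_eqI[OF _ ge])
    let ?A = "{max_corr law (coord_sigma {k. k $ u \<in> G}) (coord_sigma {k. k $ u \<in> H}) | u G H.
      G \<noteq> {} \<and> H \<noteq> {} \<and> G \<inter> H = {} \<and> (\<forall>g\<in>G. \<forall>h\<in>H. real n \<le> real_of_int \<bar>g - h\<bar>)}"
    have "max_corr law (coord_sigma {k. k $ u0 \<in> {..0}}) (coord_sigma {k. k $ u0 \<in> {0 + int n..}}) \<in> ?A"
    proof (intro CollectI exI conjI refl ballI)
      show "real n \<le> real_of_int \<bar>g - h\<bar>" if "g \<in> {..0}" "h \<in> {0 + int n..}" for g h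
        using that by auto
    qed (use n in auto)
    then show "?m \<in> ?A" by simp
    fix y assume "y \<in> ?A"
    then obtain u G H where y: "y = max_corr law (coord_sigma {k. k $ u \<in> G}) (coord_sigma {k. k $ u \<in> H})"
      and GH: "G \<inter> H = {}" "\<forall>g\<in>G. \<forall>h\<in>H. real n \<le> real_of_int \<bar>g - h\<bar>"
      by blast
    have "int n \<le> \<bar>g - h\<bar>" if "g \<in> G" "h \<in> H" for g h
      using GH(2) that by (metis of_int_le_iff of_int_of_nat_eq)
    then show "y \<le> v" unfolding y using GH(1) by (intro le)
  qed
qed

end

theorem theorem1p5:
  fixes N :: nat and c :: "nat \<Rightarrow> real"
  assumes "CARD('d::finite) \<ge> 2"
    and "N \<ge> 2"
    and "\<forall>n\<ge>1. 0 \<le> c n \<and> c n \<le> 1"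
    and "\<forall>m n. 1 \<le> m \<and> m \<le> n \<longrightarrow> c n \<le> c m"
  shows "\<exists>(M :: (int^'d \<Rightarrow> real) measure) (X :: int^'d \<Rightarrow> (int^'d \<Rightarrow> real) \<Rightarrow> real).
    prob_space M \<and> (\<forall>k. X k \<in> borel_measurable M) \<and>
    strictly_stationary M X \<and>
    distr M borel (X 0) = uniform_measure lborel {0..1::real} \<and>
    tuplewise_indep M X N \<and>
    (\<forall>n\<ge>1. rho_star M X n = 1) \<and> rho_coef M X 1 = 1 \<and> rho_prime M X 1 = 1 \<and>
    (\<forall>n\<ge>2. rho_coef M X n = c n \<and> rho_prime M X n = c n)"
proof -
  obtain u0 v0 :: 'd where uv: "u0 \<noteq> v0"
    using assms(1) by (metis (full_types) UNIV_I card_1_singletonE card_le_Suc0_iff_eq finite not_less_eq_eq numeral_2_eq_2)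
  interpret mixing_field N c u0 v0
    using assms uv by unfold_locales auto
  let ?X = "\<lambda>(k :: int^'d) x. x k :: real"
  show ?thesis
  proof (intro exI[of _ law] exI[of _ ?X] conjI allI impI)
    show "prob_space law" by (rule law.prob_space_axioms)
    show "?X k \<in> borel_measurable law" for k by (rule coord_measurable)
    show "strictly_stationary law ?X" unfolding strictly_stationary_def using law_stationary by blast
    show "distr law borel (?X 0) = uniform_measure lborel {0..1}" by (rule law_uniform)
    show "tuplewise_indep law ?X N"
      unfolding tuplewise_indep_def
    proof (intro allI impI)
      fix K :: "(int^'d) set" assume "finite K \<and> card K = N"
      then show "law.indep_vars (\<lambda>_. borel) ?X K"
        \<comment> \<open>A cluster has \<open>2 * half_size N b \<ge> 2 * N > N\<close>
          points.\<close>
        using N by (intro law_indep) (auto simp: half_size_def)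
    qed
    show "rho_star law ?X n = 1" for n by (rule rho_star_law)
    \<comment> \<open>At distance 1 a bias-1 block attains the trivial upper bound.\<close>
    have "scale (True, 0) = 1" "block_bias c (True, 0) = 1"
      by (simp_all add: scale_def block_bias_def)
    from rho_law[OF order_refl this law.max_corr_le_1]
    show "rho_coef law ?X 1 = 1" "rho_prime law ?X 1 = 1" .
    fix n :: nat assume n: "2 \<le> n"
    then have "n - 2 + 2 = n" by simp
    \<comment> \<open>The shapes \<open>(False, m)\<close> start at scale 2, whence the offset in
      \<open>n - 2\<close>.\<close>
    then have b: "1 \<le> n" "scale (False, n - 2) = n" "block_bias c (False, n - 2) = c n"
      using n by (simp_all only: scale_def block_bias_def fst_conv snd_conv if_False)
    show "rho_coef law ?X n = c n" "rho_prime law ?X n = c n"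
      by (rule rho_law[OF b max_corr_strip_le[OF _ _ n]]; assumption)+
  qed
qed

end
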